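(* Let $\mathbf{X}\in\mathbb{R}^{n\times T}$, $1\le k\le n$, and suppose $\mathbf{C}=\frac1T\mathbf{X}\mathbf{X}^\top$ is positive definite with eigenvalues $\sigma_1\ge\cdots\ge\sigma_n>0$ and orthonormal eigenvectors $\mathbf v_1,\dots,\mathbf v_n$. Consider, for $\tau>0$, the dynamical system in $\mathbf{W}(t)\in\mathbb{R}^{k\times n}$ and symmetric invertible $\mathbf{M}(t)\in\mathbb{R}^{k\times k}$: $$\mathbf{Y}=\mathbf{M}^{-1}\mathbf{W}\mathbf{X},\qquad \frac{d\mathbf{W}}{dt}=\frac2T\mathbf{Y}\mathbf{X}^\top-2\mathbf{W},\qquad \tau\frac{d\mathbf{M}}{dt}=\frac1T\mathbf{Y}\mathbf{Y}^\top-\mathbf{I}_k,$$ with filter matrix $\mathbf F=\mathbf M^{-1}\mathbf W$. Then every fixed point $(\bar{\mathbf W},\bar{\mathbf M})$ with $\bar{\mathbf M}$ invertible, with $\bar{\mathbf F}=\bar{\mathbf M}^{-1}\bar{\mathbf W}$ and $\bar{\mathbf Y}=\bar{\mathbf F}\mathbf X$, satisfies: (1) $\frac1T\bar{\mathbf Y}\bar{\mathbf Y}^\top=\mathbf I_k$; (2) the row space of $\bar{\mathbf F}$ is a $k$-dimensional subspace of $\mathbb R^n$ spanned by some $k$ eigenvectors of $\mathbf C$; (3) relabel the eigenpairs so that the row space of $\bar{\mathbf F}$ is $\mathrm{span}\{\mathbf v_1,\ldots,\mathbf v_k\}$; if the fixed point is linearly stable then $\min_{i\le k}\sigma_i>\max_{j>k}\sigma_j$,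 i.e. the rows of $\bar{\mathbf F}$ span the principal subspace; (4) if the rows of $\bar{\mathbf F}$ span the principal subspace (top eigenvalues $\sigma_1,\dots,\sigma_k$, with $\sigma_k\ne\sigma_{k+1}$), the fixed point is linearly stable if and only if $\tau<\frac{\sigma_i+\sigma_j}{2(\sigma_i-\sigma_j)^2}$ for all pairs $i\neq j$ in $\{1,\ldots,k\}$ (the right-hand side read as $+\infty$ when $\sigma_i=\sigma_j$).
   Context: Define normalized filters $\mathbf R=\mathbf F\mathbf C^{1/2}$. Linear stability of a fixed point means: for the linearization of the system around it (with symmetric perturbations $\delta\mathbf M$), every solution converges as $t\to\infty$ to a perturbation whose induced perturbation of the normalized filters $\delta\mathbf R=-\bar{\mathbf M}^{-1}\delta\mathbf M\,\bar{\mathbf R}+\bar{\mathbf M}^{-1}\delta\mathbf W\,\mathbf C^{1/2}$ has the form $\delta\mathbf A\,\bar{\mathbf R}$ with $\delta\mathbf A$ skew-symmetric, i.e. the (normalized) filters converge to a rotation of the original ones within their row space. *)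

theory Defs
  imports "HOL-Analysis.Analysis"
begin

definition datacov :: "real^'t^'n \<Rightarrow> real^'n^'n" where
  "datacov X = (1 / real CARD('t)) *\<^sub>R (X ** transpose X)"

definition mat_sqrt :: "real^'n^'n \<Rightarrow> real^'n^'n" where
  "mat_sqrt C = (THE S. transpose S = S \<and> (\<forall>x. 0 \<le> x \<bullet> (S *v x)) \<and> S ** S = C)"

definition fixed_point :: "real^'t^'n \<Rightarrow> real^'n^'k \<Rightarrow> real^'k^'k \<Rightarrow> bool" where
  "fixed_point X W M \<longleftrightarrow> transpose M = M \<and> invertible M \<and>
     (let Y = matrix_inv M ** W ** X; T = real CARD('t) in
        (2 / T) *\<^sub>R (Y ** transpose X) - 2 *\<^sub>R W = 0 \<and>
        (1 / T) *\<^sub>R (Y ** transpose Y) - mat 1 = 0)"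

text \<open>Linearization of the vector field (dW/dt, dM/dt) around (W,M), applied to a
  perturbation (dW, dM). Here dF = M^-1 dW - M^-1 dM M^-1 W is the induced perturbation
  of F = M^-1 W, and dY = dF X.\<close>
definition lin_field :: "real^'t^'n \<Rightarrow> real \<Rightarrow> real^'n^'k \<Rightarrow> real^'k^'k
     \<Rightarrow> ((real^'n^'k) \<times> (real^'k^'k)) \<Rightarrow> ((real^'n^'k) \<times> (real^'k^'k))" where
  "lin_field X tau W M p =
     (let T = real CARD('t); Mi = matrix_inv M; Yb = Mi ** W ** X;
          dW = fst p; dM = snd p;
          dF = Mi ** dW - Mi ** dM ** Mi ** W; dY = dF ** X in
      ((2 / T) *\<^sub>R (dY ** transpose X) - 2 *\<^sub>R dW,
       (1 / tau) *\<^sub>R ((1 / T) *\<^sub>R (dY ** transpose Yb + Yb ** transpose dY))))"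

text \<open>Induced perturbation of the normalized filters R = F C^(1/2):
  dR = - M^-1 dM R + M^-1 dW C^(1/2).\<close>
definition pert_R :: "real^'t^'n \<Rightarrow> real^'n^'k \<Rightarrow> real^'k^'k
     \<Rightarrow> ((real^'n^'k) \<times> (real^'k^'k)) \<Rightarrow> real^'n^'k" where
  "pert_R X W M p =
     (let Mi = matrix_inv M; S = mat_sqrt (datacov X); Rb = Mi ** W ** S in
      - (Mi ** snd p ** Rb) + Mi ** fst p ** S)"

definition lin_stable :: "real^'t^'n \<Rightarrow> real \<Rightarrow> real^'n^'k \<Rightarrow> real^'k^'k \<Rightarrow> bool" where
  "lin_stable X tau W M \<longleftrightarrow>
     (\<forall>x :: real \<Rightarrow> ((real^'n^'k) \<times> (real^'k^'k)).
        (\<forall>t\<ge>0. (x has_vector_derivative lin_field X tau W M (x t)) (at t within {0..})) \<and>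
        (\<forall>t\<ge>0. transpose (snd (x t)) = snd (x t)) \<longrightarrow>
        (\<exists>l. (x \<longlongrightarrow> l) at_top \<and>
             (\<exists>A :: real^'k^'k. transpose A = - A \<and>
                 pert_R X W M l = A ** (matrix_inv M ** W ** mat_sqrt (datacov X)))))"

end

theory Submission
  imports Defs
begin

text \<open>At a fixed point \<open>F C = M F\<close> and \<open>F C F\<^sup>T = I\<close>, so the row space of \<open>F\<close> is \<open>C\<close>-invariant and
  hence spanned by eigenvectors. If it is spanned by \<open>v\<^sub>i\<close>, \<open>i \<in> I\<close>, the vectors
  \<open>u\<^sub>i = \<surd>\<sigma>\<^sub>i F v\<^sub>i\<close> form an orthonormal eigenbasis of \<open>M\<close>, and in the bases \<open>u\<close>, \<open>v\<close> the
  linearization decouples. For \<open>a \<in> I\<close>, \<open>j \<notin> I\<close> one gets \<open>\<delta>W\<^sub>a\<^sub>j' = 2 (\<sigma>\<^sub>j / \<sigma>\<^sub>a - 1) \<delta>W\<^sub>a\<^sub>j\<close>, which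
  decays iff \<open>\<sigma>\<^sub>j < \<sigma>\<^sub>a\<close>. For \<open>a, b \<in> I\<close> the triple \<open>(\<delta>R\<^sub>a\<^sub>b, \<delta>R\<^sub>b\<^sub>a, \<delta>M\<^sub>a\<^sub>b)\<close> obeys a closed linear
  system whose kernel is the rotation direction and whose other two eigenvalues solve
  \<open>\<lambda>\<^sup>2 + P \<lambda> + 2 P = 0\<close> with \<open>P = ((\<sigma>\<^sub>a + \<sigma>\<^sub>b) / \<tau> - 2 (\<sigma>\<^sub>a - \<sigma>\<^sub>b)\<^sup>2) / (\<sigma>\<^sub>a \<sigma>\<^sub>b)\<close>; stability is \<open>P > 0\<close>.\<close>

section \<open>Matrices in orthonormal bases\<close>

lemma orthonormal_expansion:
  fixes u :: "'i \<Rightarrow> 'a::euclidean_space"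
  assumes card: "card I = DIM('a)"
    and orth: "\<And>i j. \<lbrakk>i \<in> I; j \<in> I\<rbrakk> \<Longrightarrow> u i \<bullet> u j = (if i = j then 1 else 0)"
  shows "x = (\<Sum>i\<in>I. (u i \<bullet> x) *\<^sub>R u i)"
proof -
  have fin: "finite I"
    using card DIM_positive card_ge_0_finite by metis
  have inj: "inj_on u I"
    by (rule inj_onI) (metis orth zero_neq_one)
  have ind: "independent (u ` I)"
  proof (rule pairwise_orthogonal_independent)
    show "pairwise orthogonal (u ` I)"
      using orth by (auto simp: pairwise_def orthogonal_def)
    show "0 \<notin> u ` I"
      using orth by force
  qed
  have "span (u ` I) = UNIV"
    using ind inj card card_eq_dim[of "u ` I" UNIV] fin by (auto simp: card_image)
  let ?y = "x - (\<Sum>i\<in>I. (u i \<bullet> x) *\<^sub>R u i)"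
  have "orthogonal ?y ?y"
  proof (rule orthogonal_to_span)
    show "?y \<in> span (u ` I)"
      using \<open>span (u ` I) = UNIV\<close> by simp
    fix y assume "y \<in> u ` I"
    then obtain j where j: "j \<in> I" "y = u j" by auto
    have "(\<Sum>i\<in>I. (u i \<bullet> x) *\<^sub>R u i) \<bullet> u j = (\<Sum>i\<in>I. if i = j then u i \<bullet> x else 0)"
      unfolding inner_sum_left using j(1) orth by (intro sum.cong) auto
    then show "orthogonal ?y y"
      using j fin by (simp add: orthogonal_def inner_diff_left inner_diff_right inner_commute)
  qed
  then show ?thesis
    by (simp add: orthogonal_self)
qed

definition outer :: "real^'m \<Rightarrow> real^'n \<Rightarrow> real^'n^'m" where
  "outer x y = (\<chi> i j. x $ i * y $ j)"

lemma outer_mult_vec [simp]: "outer x y *v z = (y \<bullet> z) *\<^sub>R x"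
  by (simp add: outer_def vec_eq_iff matrix_vector_mult_def inner_vec_def sum_distrib_left mult_ac)

lemma matrix_vector_mult_sum_left:
  "(\<Sum>i\<in>I. A i) *v x = (\<Sum>i\<in>I. A i *v (x :: real^'n))"
  by (induct I rule: infinite_finite_induct) (simp_all add: matrix_vector_mult_add_rdistrib)

lemma matrix_vector_mult_sum_right:
  "(A :: real^'n^'m) *v (\<Sum>i\<in>I. f i) = (\<Sum>i\<in>I. A *v f i)"
  by (induct I rule: infinite_finite_induct) (simp_all add: matrix_vector_right_distrib)

lemma matrix_scaleR_mult_vec: "(c *\<^sub>R (A :: real^'n^'m)) *v x = c *\<^sub>R (A *v x)"
  by (simp add: scaleR_matrix_vector_assoc)

lemma matrix_expansion:
  fixes A :: "real^'n^'m" and u :: "'i \<Rightarrow> real^'m" and v :: "'j \<Rightarrow> real^'n"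
  assumes "card I = CARD('m)"
    and "\<And>i j. \<lbrakk>i \<in> I; j \<in> I\<rbrakk> \<Longrightarrow> u i \<bullet> u j = (if i = j then 1 else 0)"
    and "card J = CARD('n)"
    and "\<And>i j. \<lbrakk>i \<in> J; j \<in> J\<rbrakk> \<Longrightarrow> v i \<bullet> v j = (if i = j then 1 else 0)"
  shows "A = (\<Sum>i\<in>I. \<Sum>j\<in>J. (u i \<bullet> (A *v v j)) *\<^sub>R outer (u i) (v j))"
proof (rule iffD2[OF matrix_eq], rule allI)
  fix x
  have U: "y = (\<Sum>i\<in>I. (u i \<bullet> y) *\<^sub>R u i)" for y
    using assms(1,2) by (intro orthonormal_expansion) auto
  have V: "y = (\<Sum>i\<in>J. (v i \<bullet> y) *\<^sub>R v i)" for y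
    using assms(3,4) by (intro orthonormal_expansion) auto
  have "A *v x = (\<Sum>i\<in>I. (u i \<bullet> (A *v (\<Sum>j\<in>J. (v j \<bullet> x) *\<^sub>R v j))) *\<^sub>R u i)"
    using U[of "A *v x"] V[of x] by simp
  then show "A *v x = (\<Sum>i\<in>I. \<Sum>j\<in>J. (u i \<bullet> (A *v v j)) *\<^sub>R outer (u i) (v j)) *v x"
    by (simp add: matrix_vector_mult_sum_left matrix_vector_mult_sum_right inner_sum_right
        matrix_vector_mult_scaleR matrix_scaleR_mult_vec scaleR_sum_left mult_ac)
qed

lemma matrix_eq_coordsI:
  fixes A B :: "real^'n^'m" and u :: "'i \<Rightarrow> real^'m" and v :: "'j \<Rightarrow> real^'n"
  assumes "card I = CARD('m)"
    and "\<And>i j. \<lbrakk>i \<in> I; j \<in> I\<rbrakk> \<Longrightarrow> u i \<bullet> u j = (if i = j then 1 else 0)"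
    and "card J = CARD('n)"
    and "\<And>i j. \<lbrakk>i \<in> J; j \<in> J\<rbrakk> \<Longrightarrow> v i \<bullet> v j = (if i = j then 1 else 0)"
    and eq: "\<And>i j. \<lbrakk>i \<in> I; j \<in> J\<rbrakk> \<Longrightarrow> u i \<bullet> (A *v v j) = u i \<bullet> (B *v v j)"
  shows "A = B"
proof -
  note exp = matrix_expansion[of I u J v, OF assms(1-4)]
  have "A = (\<Sum>i\<in>I. \<Sum>j\<in>J. (u i \<bullet> (A *v v j)) *\<^sub>R outer (u i) (v j))"
    by (rule exp)
  also have "\<dots> = (\<Sum>i\<in>I. \<Sum>j\<in>J. (u i \<bullet> (B *v v j)) *\<^sub>R outer (u i) (v j))"
    using eq by simp
  also have "\<dots> = B"
    by (rule exp[symmetric])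
  finally show ?thesis .
qed

lemma coords_of_expansion:
  fixes u :: "'i \<Rightarrow> real^'m" and v :: "'j \<Rightarrow> real^'n"
  assumes "finite I" "finite J"
    and u: "\<And>i j. \<lbrakk>i \<in> I; j \<in> I\<rbrakk> \<Longrightarrow> u i \<bullet> u j = (if i = j then 1 else 0)"
    and v: "\<And>i j. \<lbrakk>i \<in> J; j \<in> J\<rbrakk> \<Longrightarrow> v i \<bullet> v j = (if i = j then 1 else 0)"
    and "a \<in> I" "b \<in> J"
  shows "u a \<bullet> ((\<Sum>i\<in>I. \<Sum>j\<in>J. c i j *\<^sub>R outer (u i) (v j)) *v v b) = c a b"
proof -
  have "u a \<bullet> ((\<Sum>i\<in>I. \<Sum>j\<in>J. c i j *\<^sub>R outer (u i) (v j)) *v v b)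
      = (\<Sum>i\<in>I. \<Sum>j\<in>J. c i j * (v j \<bullet> v b) * (u a \<bullet> u i))"
    by (simp add: matrix_vector_mult_sum_left matrix_scaleR_mult_vec inner_sum_right mult_ac)
  also have "\<dots> = (\<Sum>i\<in>I. \<Sum>j\<in>J. if j = b then (if i = a then c i j else 0) else 0)"
    using assms by (intro sum.cong refl) (auto simp: u v)
  also have "\<dots> = c a b"
    using assms by simp
  finally show ?thesis .
qed

lemma invariant_subspace_eigencomponents:
  fixes C :: "real^'n^'n"
  assumes U: "subspace U" and inv: "\<And>x. x \<in> U \<Longrightarrow> C *v x \<in> U"
    and "finite S" and "\<And>s. s \<in> S \<Longrightarrow> C *v g s = s *\<^sub>R g s" and "(\<Sum>s\<in>S. g s) \<in> U"
  shows "\<forall>s\<in>S. g s \<in> U"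
  using assms(3-5)
proof (induction S arbitrary: g rule: finite_induct)
  case empty
  then show ?case by simp
next
  case (insert a S)
  let ?x = "\<Sum>s\<in>insert a S. g s"
  have "C *v ?x - a *\<^sub>R ?x \<in> U"
    using insert.prems inv U by (intro subspace_diff subspace_scale) auto
  moreover have "C *v ?x - a *\<^sub>R ?x = (\<Sum>s\<in>S. (s - a) *\<^sub>R g s)"
    using insert by (simp add: matrix_vector_mult_sum_right scaleR_sum_right algebra_simps
        sum_subtractf)
  ultimately have "\<forall>s\<in>S. (s - a) *\<^sub>R g s \<in> U"
    using insert.prems(1) by (intro insert.IH) (auto simp: matrix_vector_mult_scaleR)
  then have S: "g s \<in> U" if "s \<in> S" for s
  proof -
    have "s - a \<noteq> 0"
      using that insert.hyps(2) by auto
    then show ?thesis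
      using subspace_scale[OF U, of "(s - a) *\<^sub>R g s" "inverse (s - a)"] \<open>\<forall>s\<in>S. _\<close> that by simp
  qed
  then have "?x - (\<Sum>s\<in>S. g s) \<in> U"
    using insert.prems(2) subspace_sum[OF U, of S g, OF S] by (intro subspace_diff[OF U])
  then show ?case
    using S insert.hyps by simp
qed

lemma invariant_subspace_eigenbasis:
  fixes C :: "real^'n^'n" and v :: "'n \<Rightarrow> real^'n"
  assumes U: "subspace U" and inv: "\<And>x. x \<in> U \<Longrightarrow> C *v x \<in> U"
    and eig: "\<And>i. C *v v i = \<sigma> i *\<^sub>R v i"
    and orth: "\<And>i j. v i \<bullet> v j = (if i = j then 1 else 0)"
  obtains E where "E \<subseteq> {u. u \<noteq> 0 \<and> (\<exists>c. C *v u = c *\<^sub>R u)}" "card E = dim U" "span E = U"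
proof -
  let ?G = "{u \<in> U. \<exists>c. C *v u = c *\<^sub>R u}"
  obtain E where E: "E \<subseteq> ?G" "independent E" "?G \<subseteq> span E" "card E = dim ?G"
    using basis_exists by blast
  have "U \<subseteq> span ?G"
  proof
    fix x assume x: "x \<in> U"
    define g where "g s = (\<Sum>i | \<sigma> i = s. (v i \<bullet> x) *\<^sub>R v i)" for s
    have gC: "C *v g s = s *\<^sub>R g s" for s
      by (simp add: g_def matrix_vector_mult_sum_right matrix_vector_mult_scaleR eig
          scaleR_sum_right mult_ac)
    have "x = (\<Sum>i\<in>UNIV. (v i \<bullet> x) *\<^sub>R v i)"
      using orth by (intro orthonormal_expansion) auto
    also have "\<dots> = (\<Sum>s\<in>range \<sigma>. g s)"
      unfolding g_def using sum.image_gen[of UNIV "\<lambda>i. (v i \<bullet> x) *\<^sub>R v i" \<sigma>] by simp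
    finally have xg: "x = (\<Sum>s\<in>range \<sigma>. g s)" .
    then have "\<forall>s\<in>range \<sigma>. g s \<in> U"
      using x gC by (intro invariant_subspace_eigencomponents[OF U inv]) auto
    then show "x \<in> span ?G"
      using gC by (subst xg) (intro span_sum span_base, auto)
  qed
  moreover have "span E \<subseteq> U"
    using E(1) U by (metis (no_types, lifting) mem_Collect_eq span_minimal subset_iff)
  ultimately have sp: "span E = U"
    using E(3) by (metis (no_types, lifting) span_minimal subset_antisym subset_trans subspace_span)
  moreover have "0 \<notin> E"
    using E(2) dependent_zero by blast
  moreover have "card E = dim U"
    using E(2) sp indep_card_eq_dim_span[of E] by (metis dim_span)
  ultimately show ?thesis
    using E(1) by (intro that[of E]) auto
qed

lemma mat_sqrt_eigenvector:
  fixes C :: "real^'n^'n" and v :: "'n \<Rightarrow> real^'n"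
  assumes eig: "\<And>i. C *v v i = \<sigma> i *\<^sub>R v i"
    and orth: "\<And>i j. v i \<bullet> v j = (if i = j then 1 else 0)"
    and pos: "\<And>i. \<sigma> i > 0"
  shows "mat_sqrt C *v v i = sqrt (\<sigma> i) *\<^sub>R v i"
proof -
  let ?P = "\<lambda>S. transpose S = S \<and> (\<forall>x. 0 \<le> x \<bullet> (S *v x)) \<and> S ** S = C"
  define S where "S = (\<Sum>i\<in>UNIV. sqrt (\<sigma> i) *\<^sub>R outer (v i) (v i))"
  note expand = matrix_eq_coordsI[of UNIV v UNIV v, OF refl orth refl orth]
  have Sx: "S *v x = (\<Sum>i\<in>UNIV. (sqrt (\<sigma> i) * (v i \<bullet> x)) *\<^sub>R v i)" for x
    by (simp add: S_def matrix_vector_mult_sum_left matrix_scaleR_mult_vec)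
  have Sv: "S *v v i = sqrt (\<sigma> i) *\<^sub>R v i" for i
    unfolding Sx orth by (simp add: if_distrib[of "\<lambda>x. _ * x"] if_distrib[of "\<lambda>x. x *\<^sub>R _"] cong: if_cong)
  have "?P S"
  proof (intro conjI allI)
    show "transpose S = S"
    proof (rule expand)
      fix i j
      have "v i \<bullet> (transpose S *v v j) = v j \<bullet> (S *v v i)"
        by (metis dot_lmul_matrix inner_commute transpose_matrix_vector)
      then show "v i \<bullet> (transpose S *v v j) = v i \<bullet> (S *v v j)"
        by (simp add: Sv orth)
    qed
    show "0 \<le> x \<bullet> (S *v x)" for x
      unfolding Sx inner_sum_right using pos by (intro sum_nonneg) (auto simp: inner_commute mult.assoc less_imp_le)
    show "S ** S = C"
      by (rule expand) (simp add: eig Sv less_imp_le[OF pos] matrix_vector_mult_scaleR flip: matrix_vector_mul_assoc)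
  qed
  moreover have unique: "S' *v v i = sqrt (\<sigma> i) *\<^sub>R v i" if S': "?P S'" for S' i
  proof -
    let ?w = "S' *v v i - sqrt (\<sigma> i) *\<^sub>R v i"
    have "S' *v (S' *v v i) = \<sigma> i *\<^sub>R v i"
      using S' eig by (simp add: matrix_vector_mul_assoc)
    then have "S' *v ?w = - sqrt (\<sigma> i) *\<^sub>R ?w"
      using pos[of i] by (simp add: matrix_vector_mult_diff_distrib matrix_vector_mult_scaleR algebra_simps)
    moreover have "0 \<le> ?w \<bullet> (S' *v ?w)"
      using S' by blast
    ultimately have "0 \<le> - (sqrt (\<sigma> i) * (?w \<bullet> ?w))"
      by (simp only: inner_scaleR_right mult_minus_left)
    then have "?w \<bullet> ?w \<le> 0"
      using pos[of i] by (simp add: mult_le_0_iff not_le)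
    then show ?thesis
      by (metis antisym eq_iff_diff_eq_0 inner_eq_zero_iff inner_ge_zero)
  qed
  ultimately have "?P (mat_sqrt C)"
    unfolding mat_sqrt_def
    by (intro theI[of ?P S]) (auto intro!: expand simp: Sv)
  then show ?thesis
    by (rule unique)
qed

lemma matrix_inv_mult:
  fixes A :: "real^'n^'m"
  assumes "invertible A"
  shows "A ** matrix_inv A = mat 1" "matrix_inv A ** A = mat 1"
  using someI_ex[OF assms[unfolded invertible_def]] by (simp_all add: matrix_inv_def)

lemma inner_matrix_outer: "x \<bullet> (A *v y) = A \<bullet> outer x y"
  by (simp add: outer_def inner_vec_def matrix_vector_mult_def sum_distrib_left mult_ac)

lemma matrix_diff_rdistrib: "((A :: real^'n^'m) - B) ** D = A ** D - B ** D"
  by (simp add: vec_eq_iff matrix_matrix_mult_def left_diff_distrib sum_subtractf)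

lemma span_rows_eq_range: "span (rows A) = range (\<lambda>x. x v* (A :: real^'n^'m))"
proof -
  have "rows A = range (($) A)"
    by (auto simp: rows_def row_def)
  moreover have "x v* A = (\<Sum>i\<in>UNIV. x $ i *\<^sub>R A $ i)" for x
    by (simp add: vec_eq_iff vector_matrix_mult_def mult_ac)
  moreover have "span (range (($) A)) = range (\<lambda>x. \<Sum>i\<in>UNIV. x $ i *\<^sub>R A $ i)"
  proof (intro equalityI span_minimal)
    show "range (($) A) \<subseteq> range (\<lambda>x. \<Sum>i\<in>UNIV. x $ i *\<^sub>R A $ i)"
    proof safe
      fix i
      have "A $ i = (\<Sum>j\<in>UNIV. axis i 1 $ j *\<^sub>R A $ j)"
        by (simp add: axis_def if_distrib[of "\<lambda>x. x *\<^sub>R _"] cong: if_cong)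
      then show "A $ i \<in> range (\<lambda>x. \<Sum>i\<in>UNIV. x $ i *\<^sub>R A $ i)" by blast
    qed
    show "subspace (range (\<lambda>x. \<Sum>i\<in>UNIV. x $ i *\<^sub>R A $ i))"
      by (intro linear_subspace_image subspace_UNIV linearI)
         (simp_all add: scaleR_left_distrib sum.distrib scaleR_sum_right)
    show "range (\<lambda>x. \<Sum>i\<in>UNIV. x $ i *\<^sub>R A $ i) \<subseteq> span (range (($) A))"
      by (intro image_subsetI span_sum span_scale span_base rangeI)
  qed
  ultimately show ?thesis by simp
qed

section \<open>Linear differential equations\<close>

lemma scalar_decay:
  fixes V V' :: "real \<Rightarrow> real"
  assumes deriv: "\<And>t. t \<ge> 0 \<Longrightarrow> (V has_real_derivative V' t) (at t within {0..})"
    and le: "\<And>t. t \<ge> 0 \<Longrightarrow> V' t \<le> - c * V t"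
    and "t \<ge> 0"
  shows "V t \<le> V 0 * exp (- c * t)"
proof -
  have "V t * exp (c * t) \<le> V 0 * exp (c * 0)"
  proof (rule DERIV_nonpos_imp_decreasing_open[OF \<open>t \<ge> 0\<close>, of "\<lambda>t. V t * exp (c * t)"])
    fix x assume x: "0 < x" "x < t"
    have "(V has_real_derivative V' x) (at x within {0<..})"
      using deriv[of x] x by (auto intro: DERIV_subset)
    then have "(V has_real_derivative V' x) (at x)"
      using x at_within_open[of x "{0<..}"] by simp
    then have "((\<lambda>t. V t * exp (c * t)) has_real_derivative (V' x + c * V x) * exp (c * x)) (at x)"
      by (auto intro!: derivative_eq_intros simp: algebra_simps)
    moreover have "(V' x + c * V x) * exp (c * x) \<le> 0"
      using le[of x] x by (intro mult_nonpos_nonneg) auto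
    ultimately show "\<exists>y. ((\<lambda>t. V t * exp (c * t)) has_real_derivative y) (at x) \<and> y \<le> 0"
      by blast
  next
    have "continuous_on {0..} V"
      using deriv DERIV_continuous_on by (metis atLeast_iff)
    then show "continuous_on {0..t} (\<lambda>t. V t * exp (c * t))"
      by (intro continuous_intros) (auto elim: continuous_on_subset)
  qed
  then show ?thesis
    by (simp add: exp_minus field_simps)
qed

lemma exp_neg_tendsto_0: "c > 0 \<Longrightarrow> ((\<lambda>t::real. K * exp (- c * t)) \<longlongrightarrow> 0) at_top"
proof -
  assume "c > 0"
  have "LIM t at_top. - c * t :> at_bot"
    using \<open>c > 0\<close> by (intro filterlim_tendsto_neg_mult_at_bot[OF tendsto_const]) (auto intro: filterlim_ident)
  then show ?thesis
    by (intro tendsto_mult_right_zero filterlim_compose[OF exp_at_bot])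
qed

lemma scalar_linear_tendsto_0:
  fixes y :: "real \<Rightarrow> real"
  assumes deriv: "\<And>t. t \<ge> 0 \<Longrightarrow> (y has_real_derivative a * y t) (at t within {0..})"
    and "a < 0"
  shows "(y \<longlongrightarrow> 0) at_top"
proof -
  have "(y t)\<^sup>2 \<le> (y 0)\<^sup>2 * exp (- (- 2 * a) * t)" if "t \<ge> 0" for t
    by (rule scalar_decay[where V' = "\<lambda>t. 2 * a * (y t)\<^sup>2"])
       (use that deriv in \<open>auto intro!: derivative_eq_intros simp: power2_eq_square\<close>)
  then have "((\<lambda>t. (y t)\<^sup>2) \<longlongrightarrow> 0) at_top"
    by (intro tendsto_sandwich[OF _ _ tendsto_const exp_neg_tendsto_0[of "- 2 * a" "(y 0)\<^sup>2"]])
       (use \<open>a < 0\<close> in \<open>auto intro: eventually_at_top_linorderI[of 0]\<close>)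
  then show ?thesis
    by simp
qed

text \<open>For \<open>x' = A x\<close> with trace \<open>T\<close> and determinant \<open>D\<close>, the function
  \<open>D |x|\<^sup>2 + |adj A x|\<^sup>2\<close> has derivative \<open>2 D T |x|\<^sup>2\<close>, because \<open>A + adj A = T\<close>
  and \<open>adj A A = D\<close>.\<close>

lemma planar_linear_tendsto_0:
  fixes p q :: "real \<Rightarrow> real"
  assumes p: "\<And>t. t \<ge> 0 \<Longrightarrow> (p has_real_derivative a * p t + b * q t) (at t within {0..})"
    and q: "\<And>t. t \<ge> 0 \<Longrightarrow> (q has_real_derivative c * p t + d * q t) (at t within {0..})"
    and tr: "a + d < 0" and det: "a * d - b * c > 0"
  shows "(p \<longlongrightarrow> 0) at_top" "(q \<longlongrightarrow> 0) at_top"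
proof -
  let ?D = "a * d - b * c"
  define V where "V t = ?D * ((p t)\<^sup>2 + (q t)\<^sup>2) + (d * p t - b * q t)\<^sup>2 + (a * q t - c * p t)\<^sup>2" for t
  define K where "K = ?D + 2 * (a\<^sup>2 + b\<^sup>2 + c\<^sup>2 + d\<^sup>2)"
  define e where "e = - (2 * ?D * (a + d)) / K"
  have K: "K > 0"
    using det by (auto simp: K_def intro!: add_pos_nonneg)
  have e: "e > 0"
    unfolding e_def using mult_pos_neg[OF det tr] by (intro divide_pos_pos K) linarith
  have bound: "V t \<le> K * ((p t)\<^sup>2 + (q t)\<^sup>2)" for t
  proof -
    have *: "(x * y - z * w)\<^sup>2 \<le> 2 * (x\<^sup>2 * y\<^sup>2 + z\<^sup>2 * w\<^sup>2)" for x y z w :: real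
      using zero_le_power2[of "x * y + z * w"] by (simp add: power2_eq_square algebra_simps)
    have "0 \<le> 2 * (b\<^sup>2 * (p t)\<^sup>2 + a\<^sup>2 * (p t)\<^sup>2 + d\<^sup>2 * (q t)\<^sup>2 + c\<^sup>2 * (q t)\<^sup>2)"
      by simp
    moreover have "K * ((p t)\<^sup>2 + (q t)\<^sup>2) - V t
        = (2 * (d\<^sup>2 * (p t)\<^sup>2 + b\<^sup>2 * (q t)\<^sup>2) - (d * p t - b * q t)\<^sup>2)
          + (2 * (a\<^sup>2 * (q t)\<^sup>2 + c\<^sup>2 * (p t)\<^sup>2) - (a * q t - c * p t)\<^sup>2)
          + 2 * (b\<^sup>2 * (p t)\<^sup>2 + a\<^sup>2 * (p t)\<^sup>2 + d\<^sup>2 * (q t)\<^sup>2 + c\<^sup>2 * (q t)\<^sup>2)"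
      unfolding V_def K_def by (simp add: algebra_simps)
    ultimately show ?thesis
      using *[of d "p t" b "q t"] *[of a "q t" c "p t"] by linarith
  qed
  have V: "V t \<le> V 0 * exp (- e * t)" if "t \<ge> 0" for t
  proof (rule scalar_decay[where V' = "\<lambda>t. 2 * ?D * (a + d) * ((p t)\<^sup>2 + (q t)\<^sup>2)"])
    fix t :: real assume "t \<ge> 0"
    then show "(V has_real_derivative 2 * ?D * (a + d) * ((p t)\<^sup>2 + (q t)\<^sup>2)) (at t within {0..})"
      unfolding V_def by (auto intro!: derivative_eq_intros p q simp: power2_eq_square algebra_simps)
    have "e * V t \<le> e * (K * ((p t)\<^sup>2 + (q t)\<^sup>2))"
      using bound e by (intro mult_left_mono) auto
    moreover have "2 * ?D * (a + d) = - (e * K)"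
      using K by (simp add: e_def)
    ultimately show "2 * ?D * (a + d) * ((p t)\<^sup>2 + (q t)\<^sup>2) \<le> - e * V t"
      by (simp add: mult.assoc)
  qed fact
  have D: "?D * (p t)\<^sup>2 \<le> V t" "?D * (q t)\<^sup>2 \<le> V t" for t
  proof -
    have "0 \<le> ?D * (p t)\<^sup>2" "0 \<le> ?D * (q t)\<^sup>2"
      using det by (simp_all add: less_imp_le)
    then show "?D * (p t)\<^sup>2 \<le> V t" "?D * (q t)\<^sup>2 \<le> V t"
      unfolding V_def by (simp_all add: distrib_left add_increasing2)
  qed
  have *: "(y \<longlongrightarrow> 0) at_top" if "\<And>t. ?D * (y t)\<^sup>2 \<le> V t" for y :: "real \<Rightarrow> real"
  proof -
    have "((\<lambda>t. ?D * (y t)\<^sup>2) \<longlongrightarrow> 0) at_top"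
    proof (rule tendsto_sandwich[OF _ _ tendsto_const exp_neg_tendsto_0[OF e, of "V 0"]])
      show "\<forall>\<^sub>F t in at_top. 0 \<le> ?D * (y t)\<^sup>2"
        using det by (simp add: less_imp_le)
      show "\<forall>\<^sub>F t in at_top. ?D * (y t)\<^sup>2 \<le> V 0 * exp (- e * t)"
        using that V by (intro eventually_at_top_linorderI[of 0]) (blast intro: order_trans)
    qed
    then have "((\<lambda>t. inverse ?D * (?D * (y t)\<^sup>2)) \<longlongrightarrow> 0) at_top"
      by (rule tendsto_mult_right_zero)
    moreover have "(\<lambda>t. inverse ?D * (?D * (y t)\<^sup>2)) = (\<lambda>t. (y t)\<^sup>2)"
      using det by (simp add: mult.assoc[symmetric])
    ultimately show ?thesis
      by simp
  qed
  show "(p \<longlongrightarrow> 0) at_top" "(q \<longlongrightarrow> 0) at_top"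
    using * D by blast+
qed

text \<open>Here \<open>r1 = \<delta>R\<^sub>a\<^sub>b\<close>, \<open>r2 = \<delta>R\<^sub>b\<^sub>a\<close>, \<open>m = \<delta>M\<^sub>a\<^sub>b\<close> for eigenvalues \<open>\<alpha> = \<sigma>\<^sub>a\<close> and \<open>\<beta> = \<sigma>\<^sub>b\<close>.
  The equilibria are the multiples of \<open>(1, -1, \<beta> - \<alpha>)\<close>. The quotient by this line is the planar
  system \<open>(p, q)\<close>, and the conserved quantity \<open>L\<close> determines the limit on the line.\<close>

lemma pair_system_converges:
  fixes r1 r2 m :: "real \<Rightarrow> real"
  assumes pos: "\<alpha> > 0" "\<beta> > 0" "\<tau> > 0"
    and cond: "2 * \<tau> * (\<beta> - \<alpha>)\<^sup>2 < \<alpha> + \<beta>"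
    and r1: "\<And>t. t \<ge> 0 \<Longrightarrow> (r1 has_real_derivative
      (2 * (\<beta> - \<alpha>) * r1 t - 2 * m t - (r1 t + r2 t) / \<tau>) / \<alpha>) (at t within {0..})"
    and r2: "\<And>t. t \<ge> 0 \<Longrightarrow> (r2 has_real_derivative
      (2 * (\<alpha> - \<beta>) * r2 t - 2 * m t - (r1 t + r2 t) / \<tau>) / \<beta>) (at t within {0..})"
    and m: "\<And>t. t \<ge> 0 \<Longrightarrow> (m has_real_derivative (r1 t + r2 t) / \<tau>) (at t within {0..})"
  shows "\<exists>c. (r1 \<longlongrightarrow> c) at_top \<and> (r2 \<longlongrightarrow> - c) at_top \<and> (m \<longlongrightarrow> (\<beta> - \<alpha>) * c) at_top"
proof -
  define d where "d = \<beta> - \<alpha>"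
  define p where "p t = m t - d * r1 t" for t
  define q where "q t = r1 t + r2 t" for t
  define L where "L t = \<alpha> * r1 t - \<beta> * r2 t - 2 * d * \<tau> * m t" for t
  define k where "k = \<alpha> + \<beta> - 2 * \<tau> * d\<^sup>2"
  have k: "k > 0"
    using cond by (simp add: k_def d_def)
  define a where "a = 2 * d / \<alpha>"
  define b where "b = \<beta> / (\<alpha> * \<tau>)"
  define c where "c = - 2 * (1 / \<alpha> + 1 / \<beta>)"
  define e where "e = - (2 * d / \<beta> + (1 / \<alpha> + 1 / \<beta>) / \<tau>)"
  have p': "(p has_real_derivative a * p t + b * q t) (at t within {0..})" if "t \<ge> 0" for t
    unfolding p_def
    by (rule derivative_eq_intros r1 m that refl)+
       (use pos in \<open>simp add: a_def b_def q_def d_def field_simps\<close>)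
  have q': "(q has_real_derivative c * p t + e * q t) (at t within {0..})" if "t \<ge> 0" for t
    unfolding q_def
    by (rule derivative_eq_intros r1 r2 that refl)+
       (use pos in \<open>simp add: c_def e_def p_def d_def field_simps\<close>)
  have tr: "a + e = - k / (\<alpha> * \<beta> * \<tau>)" and det: "a * e - b * c = 2 * k / (\<alpha> * \<beta> * \<tau>)"
    using pos unfolding a_def b_def c_def e_def k_def d_def
    by (simp_all add: divide_simps power2_eq_square) (simp_all add: algebra_simps)
  have "a + e < 0" "a * e - b * c > 0"
    unfolding tr det using k pos by simp_all
  note pq = planar_linear_tendsto_0[OF p' q' this]
  have L: "L t = L 0" if "t \<ge> 0" for t
  proof (rule has_derivative_zero_constant[of "{0..}" L, THEN exE])
    show "convex {0::real..}" by simp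
    show "(L has_derivative (\<lambda>h. 0)) (at x within {0..})" if "x \<in> {0..}" for x
    proof -
      have "(L has_real_derivative 0) (at x within {0..})"
        unfolding L_def
        by (rule derivative_eq_intros r1 r2 m refl that[unfolded atLeast_iff])+
           (use pos in \<open>simp add: d_def field_simps\<close>)
      then show ?thesis
        by (simp add: has_field_derivative_def lambda_zero)
    qed
  qed (use that in auto)
  have r1_eq: "r1 t = (L 0 + \<beta> * q t + 2 * d * \<tau> * p t) / k" if "t \<ge> 0" for t
    using L[OF that] k unfolding L_def[of t] p_def q_def k_def
    by (simp add: field_simps power2_eq_square)
  have "((\<lambda>t. (L 0 + \<beta> * q t + 2 * d * \<tau> * p t) / k) \<longlongrightarrow> (L 0 + \<beta> * 0 + 2 * d * \<tau> * 0) / k) at_top"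
    using k by (intro tendsto_intros pq) auto
  then have lim1: "(r1 \<longlongrightarrow> L 0 / k) at_top"
    using r1_eq by (auto elim!: Lim_transform_eventually intro: eventually_at_top_linorderI[of 0])
  have "((\<lambda>t. q t - r1 t) \<longlongrightarrow> 0 - L 0 / k) at_top"
    by (intro tendsto_diff pq lim1)
  moreover have "((\<lambda>t. p t + d * r1 t) \<longlongrightarrow> 0 + d * (L 0 / k)) at_top"
    by (intro tendsto_add tendsto_mult tendsto_const pq lim1)
  ultimately show ?thesis
    using lim1 by (auto simp: q_def p_def d_def intro!: exI[of _ "L 0 / k"])
qed

section \<open>Fixed points\<close>

locale nondegenerate_fixed_point =
  fixes X :: "real^'t^'n" and \<tau> :: real and \<sigma> :: "'n \<Rightarrow> real" and v :: "'n \<Rightarrow> real^'n"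
    and W :: "real^'n^'k" and M :: "real^'k^'k"
  assumes tau_pos: "\<tau> > 0"
    and posdef: "\<And>x. x \<noteq> 0 \<Longrightarrow> 0 < x \<bullet> (datacov X *v x)"
    and eig: "\<And>i. datacov X *v v i = \<sigma> i *\<^sub>R v i"
    and orth: "\<And>i j. v i \<bullet> v j = (if i = j then 1 else 0)"
    and fp: "fixed_point X W M"
begin

abbreviation "C \<equiv> datacov X"
abbreviation "Mi \<equiv> matrix_inv M"
definition "F = Mi ** W"

lemma M_sym: "transpose M = M" and M_invertible: "invertible M"
  using fp by (auto simp: fixed_point_def)

lemma whitened: "(1 / real CARD('t)) *\<^sub>R ((F ** X) ** transpose (F ** X)) = mat 1"
  using fp by (auto simp: fixed_point_def F_def Let_def)

lemma scaled_gram: "(1 / real CARD('t)) *\<^sub>R (A ** X ** transpose (B ** X)) = A ** C ** transpose B"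
  unfolding datacov_def
  by (simp add: matrix_transpose_mul matrix_scalar_ac scalar_matrix_assoc matrix_mul_assoc)

lemma F_C_Ft: "F ** C ** transpose F = mat 1"
  using whitened scaled_gram by metis

lemma M_F: "M ** F = W"
  by (simp add: F_def matrix_mul_assoc matrix_inv_mult[OF M_invertible])

lemma F_C: "F ** C = W"
proof -
  have "(2 / real CARD('t)) *\<^sub>R (F ** X ** transpose X) = 2 *\<^sub>R W"
    using fp by (auto simp: fixed_point_def F_def Let_def)
  moreover have "(2 / real CARD('t)) *\<^sub>R (F ** X ** transpose X) = 2 *\<^sub>R (F ** C)"
    by (simp add: datacov_def matrix_scalar_ac scalar_matrix_assoc matrix_mul_assoc)
  ultimately show ?thesis by simp
qed

lemma C_sym: "transpose C = C"
  by (simp add: datacov_def transpose_scalar matrix_transpose_mul)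

lemma \<sigma>_pos: "\<sigma> i > 0"
proof -
  have "v i \<noteq> 0"
    using orth[of i i] by auto
  then show ?thesis
    using posdef[of "v i"] by (simp add: eig orth)
qed

lemma S_v: "mat_sqrt C *v v i = sqrt (\<sigma> i) *\<^sub>R v i"
  by (rule mat_sqrt_eigenvector[OF eig orth \<sigma>_pos])

lemma dim_rows: "dim (span (rows F)) = CARD('k)"
proof -
  have "surj ((*v) F)"
    using F_C_Ft matrix_right_invertible_surjective[of F] by (metis matrix_mul_assoc)
  then show ?thesis
    using full_rank_surjective[of F] by (simp add: row_rank_def)
qed

lemma rows_eigenbasis:
  obtains E where "E \<subseteq> {u. u \<noteq> 0 \<and> (\<exists>c. C *v u = c *\<^sub>R u)}" "card E = CARD('k)" "span E = span (rows F)"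
proof -
  have inv: "C *v x \<in> span (rows F)" if x: "x \<in> span (rows F)" for x
  proof -
    obtain y where y: "x = y v* F"
      using x unfolding span_rows_eq_range by blast
    have "C *v x = transpose (F ** C) *v y"
      by (simp add: y C_sym matrix_transpose_mul flip: matrix_vector_mul_assoc del: vector_transpose_matrix)
    also have "\<dots> = transpose (M ** F) *v y"
      by (simp only: F_C M_F)
    also have "\<dots> = (M *v y) v* F"
      by (simp only: matrix_transpose_mul M_sym flip: matrix_vector_mul_assoc) simp
    finally show ?thesis
      by (simp add: span_rows_eq_range)
  qed
  show ?thesis
  proof (rule invariant_subspace_eigenbasis[OF subspace_span inv eig orth])
    fix E assume "E \<subseteq> {u. u \<noteq> 0 \<and> (\<exists>c. C *v u = c *\<^sub>R u)}"
      "card E = dim (span (rows F))" "span E = span (rows F)"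
    then show thesis
      using that[of E] dim_rows by simp
  qed
qed

definition filter_pert :: "(real^'n^'k) \<times> (real^'k^'k) \<Rightarrow> real^'n^'k" where
  "filter_pert p = Mi ** fst p - Mi ** snd p ** F"

lemma lin_field_eq:
  "lin_field X \<tau> W M p = (2 *\<^sub>R (filter_pert p ** C) - 2 *\<^sub>R fst p,
     (1 / \<tau>) *\<^sub>R (filter_pert p ** C ** transpose F + F ** C ** transpose (filter_pert p)))"
proof -
  have "(2 / real CARD('t)) *\<^sub>R (A ** X ** transpose X) = 2 *\<^sub>R (A ** C)" for A :: "real^'n^'k"
    by (simp add: datacov_def matrix_scalar_ac scalar_matrix_assoc matrix_mul_assoc)
  then show ?thesis
    by (simp add: lin_field_def Let_def filter_pert_def F_def matrix_mul_assoc
        flip: scaled_gram) (simp add: scaleR_add_right)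
qed

lemma pert_R_eq: "pert_R X W M p = filter_pert p ** mat_sqrt C"
  by (simp add: pert_R_def Let_def filter_pert_def F_def matrix_mul_assoc matrix_diff_rdistrib)

end

locale eigen_fixed_point = nondegenerate_fixed_point X \<tau> \<sigma> v W M
  for X :: "real^'t^'n" and \<tau> :: real and \<sigma> :: "'n \<Rightarrow> real" and v :: "'n \<Rightarrow> real^'n"
    and W :: "real^'n^'k" and M :: "real^'k^'k" +
  fixes I :: "'n set"
  assumes card_I: "card I = CARD('k)"
    and span_I: "span (v ` I) = span (rows F)"
begin

text \<open>In the notation \<open>R = F C\<^sup>1\<^sup>/\<^sup>2\<close>, the vector \<open>u i\<close> is \<open>R v\<^sub>i\<close>; it is an eigenvector of \<open>M\<close>.\<close>

definition "u i = sqrt (\<sigma> i) *\<^sub>R (F *v v i)"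

lemma F_v: "F *v v i = (1 / sqrt (\<sigma> i)) *\<^sub>R u i"
  using \<sigma>_pos[of i] by (simp add: u_def)

lemma F_v_outside: "j \<notin> I \<Longrightarrow> F *v v j = 0"
proof -
  assume j: "j \<notin> I"
  have "(y v* F) \<bullet> v j = 0" for y
  proof -
    have "y v* F \<in> span (v ` I)"
      unfolding span_I span_rows_eq_range by simp
    then have "orthogonal (v j) (y v* F)"
      by (rule orthogonal_to_span) (use j orth in \<open>auto simp: orthogonal_def\<close>)
    then show ?thesis
      by (simp add: orthogonal_def inner_commute)
  qed
  then have "(F *v v j) \<bullet> (F *v v j) = 0"
    by (simp add: dot_lmul_matrix)
  then show ?thesis by simp
qed

lemma u_F: "i \<in> I \<Longrightarrow> u i v* F = (1 / sqrt (\<sigma> i)) *\<^sub>R v i"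
proof -
  assume "i \<in> I"
  then have "v i \<in> span (rows F)"
    unfolding span_I[symmetric] by (simp add: span_base)
  then obtain y where y: "v i = y v* F"
    by (auto simp: span_rows_eq_range)
  have "y = (F ** C ** transpose F) *v y"
    by (simp add: F_C_Ft)
  also have "\<dots> = F *v (C *v v i)"
    by (simp add: y flip: matrix_vector_mul_assoc)
  also have "\<dots> = sqrt (\<sigma> i) *\<^sub>R u i"
    using \<sigma>_pos[of i] by (simp add: eig u_def matrix_vector_mult_scaleR)
  finally have "v i = transpose F *v (sqrt (\<sigma> i) *\<^sub>R u i)"
    using y by simp
  then have "v i = sqrt (\<sigma> i) *\<^sub>R (u i v* F)"
    unfolding matrix_vector_mult_scaleR by simp
  then show ?thesis
    using \<sigma>_pos[of i] by simp
qed

lemma u_orth: "\<lbrakk>i \<in> I; j \<in> I\<rbrakk> \<Longrightarrow> u i \<bullet> u j = (if i = j then 1 else 0)"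
proof -
  assume "i \<in> I" "j \<in> I"
  have "u i \<bullet> u j = sqrt (\<sigma> j) * ((u i v* F) \<bullet> v j)"
    by (simp add: u_def[of j] dot_lmul_matrix)
  then show ?thesis
    using \<sigma>_pos[of i] \<sigma>_pos[of j] by (simp add: u_F \<open>i \<in> I\<close> orth)
qed

lemma M_u: "M *v u i = \<sigma> i *\<^sub>R u i"
proof -
  have "M *v u i = sqrt (\<sigma> i) *\<^sub>R ((M ** F) *v v i)"
    by (simp add: u_def matrix_vector_mult_scaleR matrix_vector_mul_assoc)
  also have "\<dots> = sqrt (\<sigma> i) *\<^sub>R (F *v (C *v v i))"
    by (simp add: M_F F_C matrix_vector_mul_assoc)
  finally show ?thesis
    by (simp add: eig u_def matrix_vector_mult_scaleR mult_ac)
qed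

lemma u_Mi: "u i \<bullet> (Mi *v x) = (u i \<bullet> x) / \<sigma> i"
proof -
  have "\<sigma> i * (u i \<bullet> (Mi *v x)) = (transpose M *v u i) \<bullet> (Mi *v x)"
    by (simp add: M_sym M_u del: transpose_matrix_vector)
  also have "\<dots> = u i \<bullet> ((M ** Mi) *v x)"
    by (simp add: dot_lmul_matrix flip: matrix_vector_mul_assoc)
  also have "\<dots> = u i \<bullet> x"
    by (simp add: matrix_inv_mult[OF M_invertible])
  finally show ?thesis
    using \<sigma>_pos[of i] by (simp add: field_simps)
qed

text \<open>Coordinates of \<open>\<delta>W\<close>, \<open>\<delta>M\<close> and \<open>\<delta>F\<close> in the bases \<open>u\<close> and \<open>v\<close>; those of \<open>\<delta>R\<close> are
  \<open>sqrt (\<sigma> j) * fc p a j\<close>.\<close>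

definition "wc p a j = u a \<bullet> (fst p *v v j)"
definition "mc p a b = u a \<bullet> (snd p *v u b)"
definition "fc p a j = (wc p a j - (if j \<in> I then mc p a j / sqrt (\<sigma> j) else 0)) / \<sigma> a"

lemma filter_pert_coord: "u a \<bullet> (filter_pert p *v v j) = fc p a j"
proof -
  have "u a \<bullet> (filter_pert p *v v j) = (u a \<bullet> (fst p *v v j) - u a \<bullet> (snd p *v (F *v v j))) / \<sigma> a"
    by (simp add: filter_pert_def matrix_vector_mult_diff_rdistrib inner_diff_right u_Mi diff_divide_distrib
        flip: matrix_vector_mul_assoc)
  then show ?thesis
    by (cases "j \<in> I")
       (simp add: fc_def wc_def mc_def F_v matrix_vector_mult_scaleR,
        simp add: fc_def wc_def F_v_outside)
qed

lemma lin_field_wc: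
  "wc (lin_field X \<tau> W M p) a j = 2 * \<sigma> j * fc p a j - 2 * wc p a j"
  unfolding wc_def[of "lin_field X \<tau> W M p"] lin_field_eq
  by (simp add: matrix_vector_mult_diff_rdistrib inner_diff_right matrix_scaleR_mult_vec
      eig matrix_vector_mult_scaleR filter_pert_coord wc_def flip: matrix_vector_mul_assoc)

lemma lin_field_mc:
  assumes "a \<in> I" "b \<in> I"
  shows "mc (lin_field X \<tau> W M p) a b = (sqrt (\<sigma> b) * fc p a b + sqrt (\<sigma> a) * fc p b a) / \<tau>"
proof -
  have *: "u a \<bullet> ((filter_pert p ** C ** transpose F) *v u b) = sqrt (\<sigma> b) * fc p a b" if "b \<in> I" for a b
    using \<sigma>_pos[of b] that
    by (simp add: u_F eig matrix_vector_mult_scaleR filter_pert_coord real_div_sqrt flip: matrix_vector_mul_assoc)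
  have "F ** C ** transpose (filter_pert p) = transpose (filter_pert p ** C ** transpose F)"
    by (simp add: matrix_transpose_mul C_sym matrix_mul_assoc)
  then have "u a \<bullet> ((F ** C ** transpose (filter_pert p)) *v u b)
      = u b \<bullet> ((filter_pert p ** C ** transpose F) *v u a)"
    by (metis dot_lmul_matrix inner_commute transpose_matrix_vector)
  with * assms show ?thesis
    by (simp add: mc_def lin_field_eq matrix_scaleR_mult_vec matrix_vector_mult_add_rdistrib inner_add_right)
qed

lemma rotation_iff:
  "(\<exists>A :: real^'k^'k. transpose A = - A \<and> pert_R X W M p = A ** (Mi ** W ** mat_sqrt C)) \<longleftrightarrow>
   (\<forall>a\<in>I. \<forall>j. j \<notin> I \<longrightarrow> fc p a j = 0) \<and>
   (\<forall>a\<in>I. \<forall>b\<in>I. sqrt (\<sigma> b) * fc p a b + sqrt (\<sigma> a) * fc p b a = 0)"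
  (is "?L \<longleftrightarrow> ?R")
proof -
  have pc: "u a \<bullet> (pert_R X W M p *v v j) = sqrt (\<sigma> j) * fc p a j" for a j
    by (simp add: pert_R_eq S_v matrix_vector_mult_scaleR filter_pert_coord flip: matrix_vector_mul_assoc)
  have Av: "u a \<bullet> ((A ** (Mi ** W ** mat_sqrt C)) *v v j) = (if j \<in> I then u a \<bullet> (A *v u j) else 0)"
    for a j and A :: "real^'k^'k"
  proof -
    have "(A ** (F ** mat_sqrt C)) *v v j = sqrt (\<sigma> j) *\<^sub>R (A *v (F *v v j))"
      by (simp add: S_v matrix_vector_mult_scaleR flip: matrix_vector_mul_assoc)
    also have "\<dots> = (if j \<in> I then A *v u j else 0)"
      using \<sigma>_pos[of j] by (simp add: F_v_outside) (simp add: F_v matrix_vector_mult_scaleR)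
    finally show ?thesis
      by (simp add: F_def)
  qed
  have skew: "u b \<bullet> (transpose A *v u a) = u a \<bullet> (A *v u b)" for a b and A :: "real^'k^'k"
    by (metis dot_lmul_matrix inner_commute transpose_matrix_vector)
  have neg: "u b \<bullet> (- A *v u a) = - (u b \<bullet> (A *v u a))" for a b and A :: "real^'k^'k"
    using matrix_scaleR_mult_vec[of "-1" A "u a"] by simp
  show ?thesis
  proof
    assume ?L
    then obtain A :: "real^'k^'k" where A: "transpose A = - A"
      "pert_R X W M p = A ** (Mi ** W ** mat_sqrt C)" by blast
    have 1: "sqrt (\<sigma> j) * fc p a j = (if j \<in> I then u a \<bullet> (A *v u j) else 0)" for a j
      using pc Av A(2) by metis
    have 2: "u a \<bullet> (A *v u b) + u b \<bullet> (A *v u a) = 0" for a b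
      using skew[of b A a] neg[of b A a] A(1) by simp
    show ?R
    proof (intro conjI ballI allI impI)
      fix a j assume "j \<notin> I"
      then show "fc p a j = 0"
        using 1[of j a] \<sigma>_pos[of j] by simp
    next
      fix a b assume "a \<in> I" "b \<in> I"
      then show "sqrt (\<sigma> b) * fc p a b + sqrt (\<sigma> a) * fc p b a = 0"
        using 1[of b a] 1[of a b] 2[of a b] by simp
    qed
  next
    assume R: ?R
    define A where "A = (\<Sum>a\<in>I. \<Sum>b\<in>I. (sqrt (\<sigma> b) * fc p a b) *\<^sub>R outer (u a) (u b))"
    have A: "u a \<bullet> (A *v u b) = sqrt (\<sigma> b) * fc p a b" if "a \<in> I" "b \<in> I" for a b
      unfolding A_def by (rule coords_of_expansion) (auto simp: that u_orth)
    have "transpose A = - A"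
    proof (rule matrix_eq_coordsI[of I u I u])
      fix a b assume ab: "a \<in> I" "b \<in> I"
      have "sqrt (\<sigma> b) * fc p a b + sqrt (\<sigma> a) * fc p b a = 0"
        using R ab by blast
      then show "u a \<bullet> (transpose A *v u b) = u a \<bullet> (- A *v u b)"
        unfolding skew neg A[OF ab] A[OF ab(2,1)] by linarith
    qed (auto simp: card_I u_orth)
    moreover have "pert_R X W M p = A ** (Mi ** W ** mat_sqrt C)"
    proof (rule matrix_eq_coordsI[of I u UNIV v])
      fix a j assume "a \<in> I"
      then show "u a \<bullet> (pert_R X W M p *v v j) = u a \<bullet> ((A ** (Mi ** W ** mat_sqrt C)) *v v j)"
        unfolding pc Av using A R by simp
    qed (auto simp: card_I u_orth orth)
    ultimately show ?L by blast
  qed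
qed

definition "recW c = (\<Sum>a\<in>I. \<Sum>j\<in>UNIV. c a j *\<^sub>R outer (u a) (v j))"
definition "recM c = (\<Sum>a\<in>I. \<Sum>b\<in>I. c a b *\<^sub>R outer (u a) (u b))"

lemma rec_coords: "p = (recW (wc p), recM (mc p))"
proof (rule prod_eqI, unfold fst_conv snd_conv)
  show "fst p = recW (wc p)"
    unfolding recW_def wc_def
    by (rule matrix_expansion[of I u UNIV v "fst p"]) (simp_all add: card_I u_orth orth)
  show "snd p = recM (mc p)"
    unfolding recM_def mc_def
    by (rule matrix_expansion[of I u I u "snd p"]) (simp_all add: card_I u_orth)
qed

lemma wc_rec: "a \<in> I \<Longrightarrow> wc (recW c, y) a j = c a j"
  unfolding wc_def recW_def fst_conv by (rule coords_of_expansion) (auto simp: u_orth orth)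

lemma mc_rec: "\<lbrakk>a \<in> I; b \<in> I\<rbrakk> \<Longrightarrow> mc (y, recM c) a b = c a b"
  unfolding mc_def recM_def snd_conv by (rule coords_of_expansion) (auto simp: u_orth)

lemma coords_eqI:
  assumes "\<And>a j. a \<in> I \<Longrightarrow> wc p a j = wc q a j"
    and "\<And>a b. \<lbrakk>a \<in> I; b \<in> I\<rbrakk> \<Longrightarrow> mc p a b = mc q a b"
  shows "p = q"
proof -
  have "recW (wc p) = recW (wc q)" "recM (mc p) = recM (mc q)"
    unfolding recW_def recM_def using assms by simp_all
  then show ?thesis
    using rec_coords by metis
qed

lemma bounded_linear_wc: "bounded_linear (\<lambda>p. wc p a j)"
  unfolding wc_def inner_matrix_outer
  by (intro bounded_linear_inner_left_comp bounded_linear_fst)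

lemma bounded_linear_mc: "bounded_linear (\<lambda>p. mc p a b)"
  unfolding mc_def inner_matrix_outer
  by (intro bounded_linear_inner_left_comp bounded_linear_snd)

lemma bounded_linear_fc: "bounded_linear (\<lambda>p. fc p a j)"
  unfolding fc_def divide_inverse
  by (cases "j \<in> I")
     (auto intro!: bounded_linear_mult_const bounded_linear_sub bounded_linear_wc bounded_linear_mc)

section \<open>The linearized flow in eigencoordinates\<close>

lemma coords_derivative:
  assumes "(x has_vector_derivative lin_field X \<tau> W M (x t)) (at t within S)"
  shows "((\<lambda>t. wc (x t) a j) has_real_derivative 2 * \<sigma> j * fc (x t) a j - 2 * wc (x t) a j) (at t within S)"
    and "\<lbrakk>a \<in> I; b \<in> I\<rbrakk> \<Longrightarrow> ((\<lambda>t. mc (x t) a b) has_real_derivative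
      (sqrt (\<sigma> b) * fc (x t) a b + sqrt (\<sigma> a) * fc (x t) b a) / \<tau>) (at t within S)"
  using bounded_linear.has_vector_derivative[OF bounded_linear_wc[of a j] assms]
    bounded_linear.has_vector_derivative[OF bounded_linear_mc[of a b] assms]
  by (simp_all add: has_real_derivative_iff_has_vector_derivative lin_field_wc lin_field_mc)

lemma mc_sym: "transpose (snd p) = snd p \<Longrightarrow> mc p a b = mc p b a"
  unfolding mc_def by (metis dot_lmul_matrix inner_commute transpose_matrix_vector)

lemma recM_sym: "(\<And>a b. \<lbrakk>a \<in> I; b \<in> I\<rbrakk> \<Longrightarrow> c a b = c b a) \<Longrightarrow> transpose (recM c) = recM c"
proof (rule matrix_eq_coordsI[of I u I u])
  fix a b assume *: "\<And>a b. \<lbrakk>a \<in> I; b \<in> I\<rbrakk> \<Longrightarrow> c a b = c b a" "a \<in> I" "b \<in> I"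
  have "u a \<bullet> (transpose (recM c) *v u b) = u b \<bullet> (recM c *v u a)"
    by (metis dot_lmul_matrix inner_commute transpose_matrix_vector)
  then show "u a \<bullet> (transpose (recM c) *v u b) = u a \<bullet> (recM c *v u b)"
    using * mc_rec[of a b 0 c] mc_rec[of b a 0 c] by (simp add: mc_def)
qed (auto simp: card_I u_orth)

lemma lin_stableI:
  assumes gap: "\<And>i j. \<lbrakk>i \<in> I; j \<notin> I\<rbrakk> \<Longrightarrow> \<sigma> j < \<sigma> i"
    and cond: "\<And>a b. \<lbrakk>a \<in> I; b \<in> I\<rbrakk> \<Longrightarrow> 2 * \<tau> * (\<sigma> b - \<sigma> a)\<^sup>2 < \<sigma> a + \<sigma> b"
  shows "lin_stable X \<tau> W M"
  unfolding lin_stable_def rotation_iff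
proof (intro allI impI, elim conjE)
  fix x :: "real \<Rightarrow> (real^'n^'k) \<times> (real^'k^'k)"
  assume ode: "\<forall>t\<ge>0. (x has_vector_derivative lin_field X \<tau> W M (x t)) (at t within {0..})"
    and sym: "\<forall>t\<ge>0. transpose (snd (x t)) = snd (x t)"
  note deriv = coords_derivative[OF ode[rule_format]]
  have outside: "((\<lambda>t. wc (x t) a j) \<longlongrightarrow> 0) at_top" if "a \<in> I" "j \<notin> I" for a j
  proof (rule scalar_linear_tendsto_0)
    show "2 * (\<sigma> j / \<sigma> a - 1) < 0"
      using gap[OF that] \<sigma>_pos[of a] by (simp add: divide_less_eq)
    show "((\<lambda>t. wc (x t) a j) has_real_derivative 2 * (\<sigma> j / \<sigma> a - 1) * wc (x t) a j) (at t within {0..})"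
      if "t \<ge> 0" for t
      using deriv(1)[OF that, of a j] \<open>j \<notin> I\<close> by (simp add: fc_def algebra_simps)
  qed
  define r where "r a b t = sqrt (\<sigma> b) * fc (x t) a b" for a b t
  have w_eq: "wc (x t) a b = (\<sigma> a * r a b t + mc (x t) a b) / sqrt (\<sigma> b)" if "b \<in> I" for a b t
    using that \<sigma>_pos[of a] \<sigma>_pos[of b] by (simp add: r_def fc_def field_simps)
  have r_eq: "r a b t = (sqrt (\<sigma> b) * wc (x t) a b - mc (x t) a b) / \<sigma> a" if "b \<in> I" for a b t
    using that \<sigma>_pos[of a] \<sigma>_pos[of b] by (simp add: r_def fc_def field_simps)
  have r': "(r a b has_real_derivative
      (2 * (\<sigma> b - \<sigma> a) * r a b t - 2 * mc (x t) a b - (r a b t + r b a t) / \<tau>) / \<sigma> a) (at t within {0..})"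
    if "a \<in> I" "b \<in> I" "t \<ge> 0" for a b t
  proof -
    have eq: "r a b = (\<lambda>t. (sqrt (\<sigma> b) * wc (x t) a b - mc (x t) a b) / \<sigma> a)"
      using r_eq that by blast
    have "sqrt (\<sigma> b) * wc (x t) a b = \<sigma> a * r a b t + mc (x t) a b"
      using w_eq[OF that(2), of t a] \<sigma>_pos[of b] by simp
    moreover have "sqrt (\<sigma> b) * (2 * \<sigma> b * fc (x t) a b - 2 * wc (x t) a b)
       = 2 * \<sigma> b * r a b t - 2 * (sqrt (\<sigma> b) * wc (x t) a b)"
      by (simp add: r_def algebra_simps)
    ultimately have "sqrt (\<sigma> b) * (2 * \<sigma> b * fc (x t) a b - 2 * wc (x t) a b)
       = 2 * \<sigma> b * r a b t - 2 * (\<sigma> a * r a b t + mc (x t) a b)"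
      by simp
    then have "(sqrt (\<sigma> b) * (2 * \<sigma> b * fc (x t) a b - 2 * wc (x t) a b)
          - (sqrt (\<sigma> b) * fc (x t) a b + sqrt (\<sigma> a) * fc (x t) b a) / \<tau>) / \<sigma> a
        = (2 * (\<sigma> b - \<sigma> a) * r a b t - 2 * mc (x t) a b - (r a b t + r b a t) / \<tau>) / \<sigma> a"
      by (simp add: r_def[of a b t] r_def[of b a t]) (simp add: algebra_simps)
    then show ?thesis
      unfolding eq
      by (rule DERIV_cong[OF DERIV_cdivide[OF DERIV_diff[OF DERIV_cmult[OF deriv(1)[OF that(3)]]
              deriv(2)[OF that(3,1,2)]]]])
  qed
  have inside: "\<exists>c. (r a b \<longlongrightarrow> c) at_top \<and> (r b a \<longlongrightarrow> - c) at_top \<and>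
      ((\<lambda>t. mc (x t) a b) \<longlongrightarrow> (\<sigma> b - \<sigma> a) * c) at_top" if ab: "a \<in> I" "b \<in> I" for a b
  proof (rule pair_system_converges[OF \<sigma>_pos \<sigma>_pos tau_pos cond[OF ab]])
    fix t :: real assume t: "t \<ge> 0"
    show "(r a b has_real_derivative
        (2 * (\<sigma> b - \<sigma> a) * r a b t - 2 * mc (x t) a b - (r a b t + r b a t) / \<tau>) / \<sigma> a) (at t within {0..})"
      using r'[OF ab t] .
    show "(r b a has_real_derivative
        (2 * (\<sigma> a - \<sigma> b) * r b a t - 2 * mc (x t) a b - (r a b t + r b a t) / \<tau>) / \<sigma> b) (at t within {0..})"
      using r'[OF ab(2,1) t] mc_sym[OF sym[rule_format, OF t], of a b] by (simp add: add.commute)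
    show "((\<lambda>t. mc (x t) a b) has_real_derivative (r a b t + r b a t) / \<tau>) (at t within {0..})"
      using deriv(2)[OF t ab] by (simp add: r_def)
  qed
  have "\<exists>c. ((\<lambda>t. wc (x t) a j) \<longlongrightarrow> c) at_top" if a: "a \<in> I" for a j
  proof (cases "j \<in> I")
    case True
    obtain c where "(r a j \<longlongrightarrow> c) at_top" "((\<lambda>t. mc (x t) a j) \<longlongrightarrow> (\<sigma> j - \<sigma> a) * c) at_top"
      using inside[OF a True] by blast
    then have "((\<lambda>t. (\<sigma> a * r a j t + mc (x t) a j) / sqrt (\<sigma> j)) \<longlongrightarrow>
        (\<sigma> a * c + (\<sigma> j - \<sigma> a) * c) / sqrt (\<sigma> j)) at_top"
      using \<sigma>_pos[of j] by (intro tendsto_intros) auto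
    then show ?thesis
      unfolding w_eq[OF True] by blast
  qed (use outside a in blast)
  then obtain w where w: "\<And>a j. a \<in> I \<Longrightarrow> ((\<lambda>t. wc (x t) a j) \<longlongrightarrow> w a j) at_top"
    by metis
  have "\<exists>c. ((\<lambda>t. mc (x t) a b) \<longlongrightarrow> c) at_top" if "a \<in> I" "b \<in> I" for a b
    using inside[OF that] by blast
  then obtain m where m: "\<And>a b. \<lbrakk>a \<in> I; b \<in> I\<rbrakk> \<Longrightarrow> ((\<lambda>t. mc (x t) a b) \<longlongrightarrow> m a b) at_top"
    by metis
  have "((\<lambda>t. (recW (wc (x t)), recM (mc (x t)))) \<longlongrightarrow> (recW w, recM m)) at_top"
    unfolding recW_def recM_def
    by (intro tendsto_Pair tendsto_sum tendsto_scaleR tendsto_const w m)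
  then have lim: "(x \<longlongrightarrow> (recW w, recM m)) at_top" (is "(x \<longlongrightarrow> ?l) at_top")
    by (simp flip: rec_coords)
  note fc_lim = bounded_linear.tendsto[OF bounded_linear_fc lim]
  have "fc ?l a j = 0" if "a \<in> I" "j \<notin> I" for a j
  proof (rule tendsto_unique[OF _ fc_lim])
    show "((\<lambda>t. fc (x t) a j) \<longlongrightarrow> 0) at_top"
      using tendsto_divide[OF outside[OF that] tendsto_const[of "\<sigma> a"]] \<sigma>_pos[of a] that
      by (simp add: fc_def)
  qed simp
  moreover have "sqrt (\<sigma> b) * fc ?l a b + sqrt (\<sigma> a) * fc ?l b a = 0" if ab: "a \<in> I" "b \<in> I" for a b
  proof (rule tendsto_unique[of at_top "\<lambda>t. r a b t + r b a t"])
    show "((\<lambda>t. r a b t + r b a t) \<longlongrightarrow> sqrt (\<sigma> b) * fc ?l a b + sqrt (\<sigma> a) * fc ?l b a) at_top"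
      unfolding r_def by (intro tendsto_add tendsto_mult tendsto_const fc_lim)
    obtain c where "(r a b \<longlongrightarrow> c) at_top" "(r b a \<longlongrightarrow> - c) at_top"
      using inside[OF ab] by blast
    from tendsto_add[OF this] show "((\<lambda>t. r a b t + r b a t) \<longlongrightarrow> 0) at_top"
      by simp
  qed simp
  ultimately show "\<exists>l. (x \<longlongrightarrow> l) at_top \<and> (\<forall>a\<in>I. \<forall>j. j \<notin> I \<longrightarrow> fc l a j = 0) \<and>
      (\<forall>a\<in>I. \<forall>b\<in>I. sqrt (\<sigma> b) * fc l a b + sqrt (\<sigma> a) * fc l b a = 0)"
    using lim by blast
qed

lemma lin_stable_limit:
  fixes w m g :: "real \<Rightarrow> 'n \<Rightarrow> 'n \<Rightarrow> real"
  assumes stable: "lin_stable X \<tau> W M"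
    and g: "\<And>t a j. g t a j = (w t a j - (if j \<in> I then m t a j / sqrt (\<sigma> j) else 0)) / \<sigma> a"
    and w': "\<And>t a j. \<lbrakk>t \<ge> 0; a \<in> I\<rbrakk> \<Longrightarrow>
      ((\<lambda>t. w t a j) has_real_derivative 2 * \<sigma> j * g t a j - 2 * w t a j) (at t within {0..})"
    and m': "\<And>t a b. \<lbrakk>t \<ge> 0; a \<in> I; b \<in> I\<rbrakk> \<Longrightarrow> ((\<lambda>t. m t a b) has_real_derivative
      (sqrt (\<sigma> b) * g t a b + sqrt (\<sigma> a) * g t b a) / \<tau>) (at t within {0..})"
    and sym: "\<And>t a b. m t a b = m t b a"
  obtains l where "\<And>a j. a \<in> I \<Longrightarrow> ((\<lambda>t. w t a j) \<longlongrightarrow> wc l a j) at_top"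
    and "\<And>a b. \<lbrakk>a \<in> I; b \<in> I\<rbrakk> \<Longrightarrow> ((\<lambda>t. m t a b) \<longlongrightarrow> mc l a b) at_top"
    and "\<And>a j. \<lbrakk>a \<in> I; j \<notin> I\<rbrakk> \<Longrightarrow> fc l a j = 0"
proof -
  define x where "x t = (recW (w t), recM (m t))" for t
  have wx: "wc (x t) a j = w t a j" if "a \<in> I" for t a j
    unfolding x_def using that by (rule wc_rec)
  have mx: "mc (x t) a b = m t a b" if "a \<in> I" "b \<in> I" for t a b
    unfolding x_def using that by (rule mc_rec)
  have gx: "fc (x t) a j = g t a j" if "a \<in> I" for t a j
    using that by (simp add: fc_def g wx mx)
  have "(x has_vector_derivative lin_field X \<tau> W M (x t)) (at t within {0..})" if t: "t \<ge> 0" for t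
  proof -
    let ?w = "\<lambda>a j. 2 * \<sigma> j * g t a j - 2 * w t a j"
    let ?m = "\<lambda>a b. (sqrt (\<sigma> b) * g t a b + sqrt (\<sigma> a) * g t b a) / \<tau>"
    have "((\<lambda>t. recW (w t)) has_vector_derivative recW ?w) (at t within {0..})"
      unfolding recW_def
      by (intro has_vector_derivative_sum)
         (use w'[OF t] in \<open>auto intro!: derivative_eq_intros\<close>)
    moreover have "((\<lambda>t. recM (m t)) has_vector_derivative recM ?m) (at t within {0..})"
      unfolding recM_def
      by (intro has_vector_derivative_sum)
         (use m'[OF t] in \<open>auto intro!: derivative_eq_intros\<close>)
    ultimately have "(x has_vector_derivative (recW ?w, recM ?m)) (at t within {0..})"
      unfolding x_def by (rule has_vector_derivative_Pair)
    moreover have "lin_field X \<tau> W M (x t) = (recW ?w, recM ?m)"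
      by (rule coords_eqI) (simp_all add: lin_field_wc lin_field_mc wc_rec mc_rec wx gx)
    ultimately show ?thesis by simp
  qed
  moreover have "transpose (snd (x t)) = snd (x t)" for t
    unfolding x_def snd_conv by (rule recM_sym) (rule sym)
  ultimately have "\<exists>l. (x \<longlongrightarrow> l) at_top \<and> (\<forall>a\<in>I. \<forall>j. j \<notin> I \<longrightarrow> fc l a j = 0) \<and>
      (\<forall>a\<in>I. \<forall>b\<in>I. sqrt (\<sigma> b) * fc l a b + sqrt (\<sigma> a) * fc l b a = 0)"
    by (intro stable[unfolded lin_stable_def rotation_iff, THEN spec, THEN mp] conjI allI impI)
  then obtain l where l: "(x \<longlongrightarrow> l) at_top"
    "\<And>a j. \<lbrakk>a \<in> I; j \<notin> I\<rbrakk> \<Longrightarrow> fc l a j = 0"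
    by blast
  show ?thesis
  proof (rule that[of l])
    show "((\<lambda>t. w t a j) \<longlongrightarrow> wc l a j) at_top" if "a \<in> I" for a j
      using bounded_linear.tendsto[OF bounded_linear_wc l(1), of a j] by (simp add: wx that)
    show "((\<lambda>t. m t a b) \<longlongrightarrow> mc l a b) at_top" if "a \<in> I" "b \<in> I" for a b
      using bounded_linear.tendsto[OF bounded_linear_mc l(1), of a b] by (simp add: mx that)
  qed (fact l(2))
qed

lemma lin_stable_imp_gap:
  assumes stable: "lin_stable X \<tau> W M" and i: "i \<in> I" and j: "j \<notin> I"
  shows "\<sigma> j < \<sigma> i"
proof (rule ccontr)
  assume "\<not> \<sigma> j < \<sigma> i"
  define lam where "lam = 2 * (\<sigma> j / \<sigma> i - 1)"
  have lam: "lam \<ge> 0"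
    using \<open>\<not> \<sigma> j < \<sigma> i\<close> \<sigma>_pos[of i] by (simp add: lam_def le_divide_eq)
  define w where "w t a b = (if a = i \<and> b = j then exp (lam * t) else 0)" for t a b
  have "\<exists>l. ((\<lambda>t. w t i j) \<longlongrightarrow> wc l i j) at_top \<and> fc l i j = 0"
  proof (rule lin_stable_limit[OF stable, of "\<lambda>t a b. w t a b / \<sigma> a" w "\<lambda>_ _ _. 0"])
    show "((\<lambda>t. w t a b) has_real_derivative 2 * \<sigma> b * (w t a b / \<sigma> a) - 2 * w t a b) (at t within {0..})" for t a b
      using \<sigma>_pos[of i]
      by (cases "a = i \<and> b = j")
         (auto simp: w_def lam_def algebra_simps intro!: derivative_eq_intros)
    show "((\<lambda>t. 0) has_real_derivative
        (sqrt (\<sigma> b) * (w t a b / \<sigma> a) + sqrt (\<sigma> a) * (w t b a / \<sigma> b)) / \<tau>) (at t within {0..})"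
      if "a \<in> I" "b \<in> I" for t a b
    proof -
      have "w t a b = 0" "w t b a = 0"
        using that j by (auto simp: w_def)
      then show ?thesis by simp
    qed
    fix l
    assume "\<And>a b. a \<in> I \<Longrightarrow> ((\<lambda>t. w t a b) \<longlongrightarrow> wc l a b) at_top"
      "\<And>a b. \<lbrakk>a \<in> I; b \<notin> I\<rbrakk> \<Longrightarrow> fc l a b = 0"
    then show "\<exists>l. ((\<lambda>t. w t i j) \<longlongrightarrow> wc l i j) at_top \<and> fc l i j = 0"
      using i j by blast
  qed simp_all
  then obtain l where l: "((\<lambda>t. w t i j) \<longlongrightarrow> wc l i j) at_top" "fc l i j = 0"
    by blast
  have "1 \<le> wc l i j"
    using lam by (intro tendsto_lowerbound[OF l(1)])
      (auto simp: w_def intro: eventually_at_top_linorderI[of 0])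
  then show False
    using l(2) j \<sigma>_pos[of i] by (simp add: fc_def)
qed

lemma lin_stable_pair_limit:
  fixes r1 r2 \<mu> :: "real \<Rightarrow> real"
  assumes stable: "lin_stable X \<tau> W M" and a: "a \<in> I" and b: "b \<in> I" and "a \<noteq> b"
    and r1: "\<And>t. (r1 has_real_derivative
      (2 * (\<sigma> b - \<sigma> a) * r1 t - 2 * \<mu> t - (r1 t + r2 t) / \<tau>) / \<sigma> a) (at t)"
    and r2: "\<And>t. (r2 has_real_derivative
      (2 * (\<sigma> a - \<sigma> b) * r2 t - 2 * \<mu> t - (r1 t + r2 t) / \<tau>) / \<sigma> b) (at t)"
    and m: "\<And>t. (\<mu> has_real_derivative (r1 t + r2 t) / \<tau>) (at t)"
  obtains c where "(\<mu> \<longlongrightarrow> c) at_top"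
proof -
  define r where "r t c e = (if c = a \<and> e = b then r1 t else if c = b \<and> e = a then r2 t else 0)" for t c e
  define m where "m t c e = (if c = a \<and> e = b \<or> c = b \<and> e = a then \<mu> t else 0)" for t c e
  define w where "w t c e = (\<sigma> c * r t c e + m t c e) / sqrt (\<sigma> e)" for t c e
  have r': "((\<lambda>t. r t c e) has_real_derivative
      (2 * (\<sigma> e - \<sigma> c) * r t c e - 2 * m t c e - (r t c e + r t e c) / \<tau>) / \<sigma> c) (at t)" for t c e
    using \<open>a \<noteq> b\<close> r1[of t] r2[of t]
    by (cases "c = a \<and> e = b"; cases "c = b \<and> e = a") (auto simp: r_def m_def add.commute)
  have m': "((\<lambda>t. m t c e) has_real_derivative (r t c e + r t e c) / \<tau>) (at t)" for t c e
    using \<open>a \<noteq> b\<close> m[of t]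
    by (cases "c = a \<and> e = b"; cases "c = b \<and> e = a") (auto simp: r_def m_def add.commute)
  have supp: "r t c e = 0" "m t c e = 0" if "e \<notin> I" for t c e
    using that a b by (auto simp: r_def m_def)
  have "\<exists>c. ((\<lambda>t. m t a b) \<longlongrightarrow> c) at_top"
  proof (rule lin_stable_limit[OF stable, of "\<lambda>t c e. r t c e / sqrt (\<sigma> e)" w m])
    show "r t c e / sqrt (\<sigma> e) = (w t c e - (if e \<in> I then m t c e / sqrt (\<sigma> e) else 0)) / \<sigma> c" for t c e
      using \<sigma>_pos[of c] \<sigma>_pos[of e] supp by (simp add: w_def field_simps)
    show "((\<lambda>t. w t c e) has_real_derivative 2 * \<sigma> e * (r t c e / sqrt (\<sigma> e)) - 2 * w t c e) (at t within {0..})" for t c e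
      unfolding w_def
      by (rule has_field_derivative_at_within, rule DERIV_cong,
          rule DERIV_cdivide[OF DERIV_add[OF DERIV_cmult[OF r'] m']])
         (use \<sigma>_pos[of c] \<sigma>_pos[of e] in \<open>simp add: field_simps\<close>)
    show "((\<lambda>t. m t c e) has_real_derivative
        (sqrt (\<sigma> e) * (r t c e / sqrt (\<sigma> e)) + sqrt (\<sigma> c) * (r t e c / sqrt (\<sigma> c))) / \<tau>) (at t within {0..})" for t c e
      using has_field_derivative_at_within[OF m'[of c e t]] \<sigma>_pos[of c] \<sigma>_pos[of e] by simp
    show "m t c e = m t e c" for t c e
      by (auto simp: m_def)
    fix l
    assume "\<And>c e. \<lbrakk>c \<in> I; e \<in> I\<rbrakk> \<Longrightarrow> ((\<lambda>t. m t c e) \<longlongrightarrow> mc l c e) at_top"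
    then show "\<exists>c. ((\<lambda>t. m t a b) \<longlongrightarrow> c) at_top"
      using a b by blast
  qed
  then show ?thesis
    using that by (auto simp: m_def)
qed

lemma lin_stable_imp_tau:
  assumes stable: "lin_stable X \<tau> W M" and a: "a \<in> I" and b: "b \<in> I" and ne: "\<sigma> a \<noteq> \<sigma> b"
  shows "2 * \<tau> * (\<sigma> b - \<sigma> a)\<^sup>2 < \<sigma> a + \<sigma> b"
proof (rule ccontr)
  define d where "d = \<sigma> b - \<sigma> a"
  have d: "d \<noteq> 0" "a \<noteq> b"
    using ne by (auto simp: d_def)
  have not_lim: False if "filterlim f at_infinity at_top" "(f \<longlongrightarrow> c) at_top" for f :: "real \<Rightarrow> real" and c
    using that not_tendsto_and_filterlim_at_infinity[of at_top f c] by simp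
  assume "\<not> 2 * \<tau> * (\<sigma> b - \<sigma> a)\<^sup>2 < \<sigma> a + \<sigma> b"
  then consider (eq) "\<sigma> a + \<sigma> b = 2 * \<tau> * d\<^sup>2" | (less) "\<sigma> a + \<sigma> b < 2 * \<tau> * d\<^sup>2"
    unfolding d_def by linarith
  then show False
  proof cases
    case eq
    \<comment> \<open>The zero eigenvalue is defective, so a Jordan chain gives a linearly growing solution.\<close>
    have sum: "\<sigma> b / (2 * d) + \<sigma> a / (2 * d) = \<tau> * d"
      using eq d by (simp add: field_simps power2_eq_square)
    obtain c where "((\<lambda>t. d * t) \<longlongrightarrow> c) at_top"
    proof (rule lin_stable_pair_limit[OF stable a b d(2),
          of "\<lambda>t. \<sigma> b / (2 * d) + t" "\<lambda>t. d * t" "\<lambda>t. \<sigma> a / (2 * d) - t"])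
      fix t
      have q: "(\<sigma> b / (2 * d) + t + (\<sigma> a / (2 * d) - t)) / \<tau> = d"
        using sum tau_pos by (simp add: field_simps)
      have 1: "(2 * (\<sigma> b - \<sigma> a) * (\<sigma> b / (2 * d) + t) - 2 * (d * t) - d) / \<sigma> a = 1"
      proof -
        have "2 * (\<sigma> b - \<sigma> a) * (\<sigma> b / (2 * d) + t) = \<sigma> b + 2 * (d * t)"
          using d unfolding d_def[symmetric] by (simp add: field_simps)
        then show ?thesis
          using \<sigma>_pos[of a] by (simp add: d_def)
      qed
      have 2: "(2 * (\<sigma> a - \<sigma> b) * (\<sigma> a / (2 * d) - t) - 2 * (d * t) - d) / \<sigma> b = - 1"
      proof -
        have neg: "\<sigma> a - \<sigma> b = - d" by (simp add: d_def)
        have "2 * (\<sigma> a - \<sigma> b) * (\<sigma> a / (2 * d) - t) = - \<sigma> a + 2 * (d * t)"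
          unfolding neg using d by (simp add: field_simps)
        then show ?thesis
          using \<sigma>_pos[of b] by (simp add: d_def)
      qed
      show "((\<lambda>t. \<sigma> b / (2 * d) + t) has_real_derivative (2 * (\<sigma> b - \<sigma> a) * (\<sigma> b / (2 * d) + t) - 2 * (d * t)
          - (\<sigma> b / (2 * d) + t + (\<sigma> a / (2 * d) - t)) / \<tau>) / \<sigma> a) (at t)"
        unfolding q 1 by (auto intro!: derivative_eq_intros)
      show "((\<lambda>t. \<sigma> a / (2 * d) - t) has_real_derivative (2 * (\<sigma> a - \<sigma> b) * (\<sigma> a / (2 * d) - t) - 2 * (d * t)
          - (\<sigma> b / (2 * d) + t + (\<sigma> a / (2 * d) - t)) / \<tau>) / \<sigma> b) (at t)"
        unfolding q 2 by (auto intro!: derivative_eq_intros)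
      show "((\<lambda>t. d * t) has_real_derivative (\<sigma> b / (2 * d) + t + (\<sigma> a / (2 * d) - t)) / \<tau>) (at t)"
        unfolding q by (auto intro!: derivative_eq_intros)
    qed
    moreover have "filterlim (\<lambda>t. d * t) at_infinity at_top"
      using d by (intro tendsto_mult_filterlim_at_infinity[OF tendsto_const])
        (auto intro: filterlim_at_top_imp_at_infinity filterlim_ident)
    ultimately show False by (rule not_lim[rotated])
  next
    case less
    \<comment> \<open>The two nonzero eigenvalues solve \<open>\<lambda>\<^sup>2 + P \<lambda> + 2 P = 0\<close>, and one of them is positive.\<close>
    define P where "P = ((\<sigma> a + \<sigma> b) / \<tau> - 2 * d\<^sup>2) / (\<sigma> a * \<sigma> b)"
    have P: "P < 0"
      unfolding P_def using less tau_pos \<sigma>_pos[of a] \<sigma>_pos[of b]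
      by (intro divide_neg_pos) (auto simp: field_simps)
    define lam where "lam = (- P + sqrt (P\<^sup>2 - 8 * P)) / 2"
    have disc: "0 \<le> P\<^sup>2 - 8 * P"
      using P zero_le_power2[of P] by linarith
    have lam: "lam > 0"
      unfolding lam_def using P real_sqrt_ge_zero[OF disc]
      by (intro divide_pos_pos add_pos_nonneg) simp_all
    have "2 * lam + P = sqrt (P\<^sup>2 - 8 * P)"
      by (simp add: lam_def field_simps)
    then have "(2 * lam + P)\<^sup>2 = P\<^sup>2 - 8 * P"
      using disc by simp
    then have "lam\<^sup>2 + P * lam + 2 * P = 0"
      by (simp add: power2_eq_square algebra_simps)
    then have "\<sigma> a * \<sigma> b * lam\<^sup>2 + (\<sigma> a * \<sigma> b * P) * (lam + 2) = 0"
      by algebra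
    moreover have "\<sigma> a * \<sigma> b * P = (\<sigma> a + \<sigma> b) / \<tau> - 2 * d\<^sup>2"
      unfolding P_def using \<sigma>_pos[of a] \<sigma>_pos[of b] by simp
    ultimately have "\<sigma> a * \<sigma> b * lam\<^sup>2 + ((\<sigma> a + \<sigma> b) / \<tau> - 2 * d\<^sup>2) * (lam + 2) = 0"
      by simp
    moreover have "(y * l - 2 * e) * (z * l + 2 * e) = - ((2 + l) * K)"
      if "y * z * l\<^sup>2 + (K - 2 * e\<^sup>2) * (l + 2) = 0" "e = z - y" for y z l e K :: real
      using that by algebra
    ultimately have char: "(\<sigma> a * lam - 2 * d) * (\<sigma> b * lam + 2 * d) = - ((2 + lam) * (\<sigma> a + \<sigma> b) / \<tau>)"
      by (simp add: d_def)
    moreover have pos: "(2 + lam) * (\<sigma> a + \<sigma> b) / \<tau> > 0"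
      using lam tau_pos \<sigma>_pos[of a] \<sigma>_pos[of b] by (simp add: add_pos_pos)
    ultimately have nz: "\<sigma> a * lam - 2 * d \<noteq> 0" "\<sigma> b * lam + 2 * d \<noteq> 0"
      by auto
    define x where "x = - ((2 + lam) / \<tau>) / (\<sigma> a * lam - 2 * d)"
    define y where "y = - ((2 + lam) / \<tau>) / (\<sigma> b * lam + 2 * d)"
    have x: "\<sigma> a * lam * x = 2 * d * x - 2 / \<tau> - lam / \<tau>"
      using nz(1) unfolding x_def by (simp add: divide_simps) (simp add: algebra_simps)
    have y: "\<sigma> b * lam * y = - 2 * d * y - 2 / \<tau> - lam / \<tau>"
      using nz(2) unfolding y_def by (simp add: divide_simps) (simp add: algebra_simps)
    have xy: "x + y = lam"
    proof -
      have "x + y = - ((2 + lam) / \<tau>) * ((\<sigma> a + \<sigma> b) * lam) / ((\<sigma> a * lam - 2 * d) * (\<sigma> b * lam + 2 * d))"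
        using nz unfolding x_def y_def by (simp add: divide_simps) (simp add: algebra_simps)
      also have "- ((2 + lam) / \<tau>) * ((\<sigma> a + \<sigma> b) * lam) = lam * - ((2 + lam) * (\<sigma> a + \<sigma> b) / \<tau>)"
        by simp
      also have "\<dots> / ((\<sigma> a * lam - 2 * d) * (\<sigma> b * lam + 2 * d)) = lam"
        unfolding char using pos by (intro nonzero_mult_div_cancel_right) linarith
      finally show ?thesis .
    qed
    obtain c where "((\<lambda>t. exp (lam * t) / \<tau>) \<longlongrightarrow> c) at_top"
    proof (rule lin_stable_pair_limit[OF stable a b d(2),
          of "\<lambda>t. x * exp (lam * t)" "\<lambda>t. exp (lam * t) / \<tau>" "\<lambda>t. y * exp (lam * t)"])
      fix t
      have q: "x * exp (lam * t) + y * exp (lam * t) = lam * exp (lam * t)"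
        by (simp add: xy flip: distrib_right)
      have "(2 * (\<sigma> b - \<sigma> a) * (x * exp (lam * t)) - 2 * (exp (lam * t) / \<tau>) - lam * exp (lam * t) / \<tau>) / \<sigma> a
          = (\<sigma> a * lam * x) * exp (lam * t) / \<sigma> a"
        unfolding x d_def by (simp add: algebra_simps)
      then show "((\<lambda>t. x * exp (lam * t)) has_real_derivative (2 * (\<sigma> b - \<sigma> a) * (x * exp (lam * t))
          - 2 * (exp (lam * t) / \<tau>) - (x * exp (lam * t) + y * exp (lam * t)) / \<tau>) / \<sigma> a) (at t)"
        unfolding q using \<sigma>_pos[of a] by (auto intro!: derivative_eq_intros)
      have "(2 * (\<sigma> a - \<sigma> b) * (y * exp (lam * t)) - 2 * (exp (lam * t) / \<tau>) - lam * exp (lam * t) / \<tau>) / \<sigma> b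
          = (\<sigma> b * lam * y) * exp (lam * t) / \<sigma> b"
        unfolding y d_def by (simp add: algebra_simps)
      then show "((\<lambda>t. y * exp (lam * t)) has_real_derivative (2 * (\<sigma> a - \<sigma> b) * (y * exp (lam * t))
          - 2 * (exp (lam * t) / \<tau>) - (x * exp (lam * t) + y * exp (lam * t)) / \<tau>) / \<sigma> b) (at t)"
        unfolding q using \<sigma>_pos[of b] by (auto intro!: derivative_eq_intros)
      show "((\<lambda>t. exp (lam * t) / \<tau>) has_real_derivative (x * exp (lam * t) + y * exp (lam * t)) / \<tau>) (at t)"
        unfolding q using tau_pos by (auto intro!: derivative_eq_intros)
    qed
    moreover have "filterlim (\<lambda>t. exp (lam * t) / \<tau>) at_infinity at_top"
    proof (rule filterlim_at_top_imp_at_infinity)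
      have "filterlim (\<lambda>t. lam * t) at_top at_top"
        using lam by (intro filterlim_tendsto_pos_mult_at_top[OF tendsto_const]) (auto intro: filterlim_ident)
      then have "filterlim (\<lambda>t. exp (lam * t)) at_top at_top"
        by (rule filterlim_compose[OF exp_at_top])
      then show "filterlim (\<lambda>t. exp (lam * t) / \<tau>) at_top at_top"
        using tau_pos filterlim_tendsto_pos_mult_at_top[OF tendsto_const, of "1 / \<tau>"] by simp
    qed
    ultimately show False by (rule not_lim[rotated])
  qed
qed

end

theorem theorem2:
  fixes X :: "real^'t^'n" and tau :: real and \<sigma> :: "'n \<Rightarrow> real" and v :: "'n \<Rightarrow> real^'n"
    and Wb :: "real^'n^'k" and Mb :: "real^'k^'k"
  assumes k_le_n: "CARD('k) \<le> CARD('n)"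
    and tau_pos: "tau > 0"
    and posdef: "\<forall>x. x \<noteq> 0 \<longrightarrow> 0 < x \<bullet> (datacov X *v x)"
    and eig: "\<forall>i. datacov X *v v i = \<sigma> i *\<^sub>R v i"
    and orth: "\<forall>i j. v i \<bullet> v j = (if i = j then 1 else 0)"
    and fp: "fixed_point X Wb Mb"
  shows "let Fb = matrix_inv Mb ** Wb; Yb = Fb ** X in
     (1 / real CARD('t)) *\<^sub>R (Yb ** transpose Yb) = mat 1 \<and>
     (dim (span (rows Fb)) = CARD('k) \<and>
      (\<exists>E. E \<subseteq> {u. u \<noteq> 0 \<and> (\<exists>c. datacov X *v u = c *\<^sub>R u)} \<and>
           card E = CARD('k) \<and> span E = span (rows Fb))) \<and>
     (\<forall>I. card I = CARD('k) \<and> span (v ` I) = span (rows Fb) \<longrightarrow>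
          lin_stable X tau Wb Mb \<longrightarrow> (\<forall>i\<in>I. \<forall>j. j \<notin> I \<longrightarrow> \<sigma> j < \<sigma> i)) \<and>
     (\<forall>I. card I = CARD('k) \<and> span (v ` I) = span (rows Fb) \<and>
          (\<forall>i\<in>I. \<forall>j. j \<notin> I \<longrightarrow> \<sigma> j < \<sigma> i) \<longrightarrow>
          (lin_stable X tau Wb Mb \<longleftrightarrow>
            (\<forall>i\<in>I. \<forall>j\<in>I. i \<noteq> j \<and> \<sigma> i \<noteq> \<sigma> j \<longrightarrow>
               tau < (\<sigma> i + \<sigma> j) / (2 * (\<sigma> i - \<sigma> j)^2))))"
proof -
  interpret nondegenerate_fixed_point X tau \<sigma> v Wb Mb
    by unfold_locales (use tau_pos posdef eig orth fp in auto)
  have tau_iff: "tau < (\<sigma> i + \<sigma> j) / (2 * (\<sigma> i - \<sigma> j)\<^sup>2) \<longleftrightarrow> 2 * tau * (\<sigma> j - \<sigma> i)\<^sup>2 < \<sigma> i + \<sigma> j"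
    if "\<sigma> i \<noteq> \<sigma> j" for i j
    using that by (simp add: pos_less_divide_eq power2_commute[of "\<sigma> j"] mult_ac)
  have gap: "\<sigma> j < \<sigma> i"
    if "card I = CARD('k)" "span (v ` I) = span (rows F)" "lin_stable X tau Wb Mb" "i \<in> I" "j \<notin> I" for I i j
  proof -
    interpret eigen_fixed_point X tau \<sigma> v Wb Mb I
      by unfold_locales (use that in auto)
    show ?thesis
      using that(3-5) by (rule lin_stable_imp_gap)
  qed
  have stable_iff: "lin_stable X tau Wb Mb \<longleftrightarrow>
      (\<forall>i\<in>I. \<forall>j\<in>I. i \<noteq> j \<and> \<sigma> i \<noteq> \<sigma> j \<longrightarrow> tau < (\<sigma> i + \<sigma> j) / (2 * (\<sigma> i - \<sigma> j)^2))" (is "_ \<longleftrightarrow> ?R")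
    if "card I = CARD('k)" "span (v ` I) = span (rows F)" and principal: "\<forall>i\<in>I. \<forall>j. j \<notin> I \<longrightarrow> \<sigma> j < \<sigma> i" for I
  proof -
    interpret eigen_fixed_point X tau \<sigma> v Wb Mb I
      by unfold_locales (use that in auto)
    show ?thesis
    proof
      assume "lin_stable X tau Wb Mb"
      then show ?R
        using lin_stable_imp_tau tau_iff by blast
    next
      assume R: ?R
      show "lin_stable X tau Wb Mb"
      proof (rule lin_stableI)
        fix a b assume "a \<in> I" "b \<in> I"
        then show "2 * tau * (\<sigma> b - \<sigma> a)\<^sup>2 < \<sigma> a + \<sigma> b"
          using R tau_iff[of a b] add_pos_pos[OF \<sigma>_pos[of a] \<sigma>_pos[of b]]
          by (cases "\<sigma> a = \<sigma> b") auto
      qed (use principal in blast)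
    qed
  qed
  obtain E where "E \<subseteq> {u. u \<noteq> 0 \<and> (\<exists>c. datacov X *v u = c *\<^sub>R u)}" "card E = CARD('k)"
    "span E = span (rows F)"
    by (rule rows_eigenbasis)
  then have basis: "\<exists>E. E \<subseteq> {u. u \<noteq> 0 \<and> (\<exists>c. datacov X *v u = c *\<^sub>R u)} \<and> card E = CARD('k) \<and>
      span E = span (rows F)"
    by blast
  show ?thesis
    unfolding Let_def F_def[symmetric]
  proof (intro conjI)
    show "\<forall>I. card I = CARD('k) \<and> span (v ` I) = span (rows F) \<longrightarrow>
        lin_stable X tau Wb Mb \<longrightarrow> (\<forall>i\<in>I. \<forall>j. j \<notin> I \<longrightarrow> \<sigma> j < \<sigma> i)"
      using gap by blast
  qed (use whitened dim_rows basis stable_iff in simp_all)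
qed

end
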